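(* Let $q=1/d$, where $d\in\mathbb{Z}$ with $|d|\ge 2$, and let $t=u/v\in\mathbb{Q}$, where $u\in\mathbb{Z}$, $v\in\mathbb{Z}_{>0}$, $\gcd(u,v)=1$ and $0<|t|<1$. Then there exist an effective constant $C_2=C_2(d,v)>0$ and positive reals $\varepsilon_2=\varepsilon_2(d,v,N)$, with $\varepsilon_2(d,v,N)\to 0$ as $|N|\to\infty$, such that \[ \left|E_q(t)-\frac{d^s}{N}\right|\ge C_2\,(2|N|)^{-\left(2+\frac{1}{3+2\sqrt3}+\varepsilon_2\right)} \] holds for all $s\in\mathbb{Z}_{>0}$ and all $N\in\mathbb{Z}$ with $|N|\ge 82836$.
   Context: For $0<|q|<1$ and $|t|<1$, the $q$-exponential function is \[ E_q(t)=\sum_{k=0}^{\infty}\frac{t^k}{\prod_{n=1}^{k}(1-q^n)}=\prod_{k=0}^{\infty}\frac{1}{1-q^kt}. \] *)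

theory Defs
  imports Complex_Main "HOL-Library.Nat_Bijection"
begin

definition q_exp :: "'a \<Rightarrow> 'a \<Rightarrow> 'a::{real_normed_field,banach}" where
  "q_exp q t = (\<Sum>k. t ^ k / (\<Prod>n=1..k. 1 - q ^ n))"

text \<open>
  Total recursive functions of arity \<open>n\<close>, in Kleene's presentation. Only the values on argument
  lists of length \<open>n\<close> are meaningful. Minimisation is restricted to regular functions, so that
  everything stays total.
\<close>

inductive recursive_fun :: "nat \<Rightarrow> (nat list \<Rightarrow> nat) \<Rightarrow> bool" where
  zero: "recursive_fun n (\<lambda>xs. 0)"
| succ: "recursive_fun 1 (\<lambda>xs. Suc (hd xs))"
| proj: "i < n \<Longrightarrow> recursive_fun n (\<lambda>xs. xs ! i)"
| comp: "recursive_fun (length fs) g \<Longrightarrow> (\<And>f. f \<in> set fs \<Longrightarrow> recursive_fun n f) \<Longrightarrow>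
    recursive_fun n (\<lambda>xs. g (map (\<lambda>f. f xs) fs))"
| prim_rec: "recursive_fun n f \<Longrightarrow> recursive_fun (Suc (Suc n)) g \<Longrightarrow>
    recursive_fun (Suc n) (\<lambda>xs. rec_nat (f (tl xs)) (\<lambda>i r. g (i # r # tl xs)) (hd xs))"
| minim: "recursive_fun (Suc n) f \<Longrightarrow> (\<And>xs. length xs = n \<Longrightarrow> \<exists>i. f (i # xs) = 0) \<Longrightarrow>
    recursive_fun n (\<lambda>xs. LEAST i. f (i # xs) = 0)"

text \<open>
  A real constant depending on two integer parameters is effective if one algorithm computes,
  from the parameters and a precision \<open>n\<close>, a dyadic approximation with error at most \<open>2\<^sup>-\<^sup>n\<close>.
  Integers are passed to and from recursive functions via the bijection \<open>int_encode\<close>.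
\<close>

definition effective_const :: "(int \<Rightarrow> int \<Rightarrow> real) \<Rightarrow> bool" where
  "effective_const C \<longleftrightarrow> (\<exists>f. recursive_fun 3 f \<and>
     (\<forall>a b n. \<bar>C a b - real_of_int (int_decode (f [int_encode a, int_encode b, n])) / 2 ^ n\<bar>
        \<le> 1 / 2 ^ n))"

end

theory Submission
  imports Defs
begin

text \<open>
  Let \<open>q = 1/d\<close>, \<open>p = |d|\<close>. The diagonal Pade approximants of \<open>E\<^sub>q\<close> satisfy
  \<open>Q\<^sub>n(T) E\<^sub>q(T) = P\<^sub>n(T) + R\<^sub>n(T)\<close>, where the coefficient of \<open>T\<^sup>k\<close> on the right is
  \<open>\<Prod>\<^bsub>n < i \<le> 2n\<^esub> (q\<^sup>k - q\<^sup>i) / \<Prod>\<^bsub>1 \<le> i \<le> k\<^esub> (1 - q\<^sup>i)\<close>; it vanishes for \<open>n < k \<le> 2n\<close>.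
  They are evaluated at \<open>T = q\<^sup>l t\<close>, which the functional equation \<open>E\<^sub>q(qt) = (1 - t) E\<^sub>q(t)\<close> turns
  into approximations of \<open>E\<^sub>q(t)\<close>. If \<open>l > n\<close>, the power of \<open>d\<close> clearing the denominators of \<open>P\<^sub>n\<close> is
  only \<open>n\<^sup>2 + ln\<close>, whereas the other linear form coefficient needs \<open>(n + l)(n + l - 1)/2\<close>; as that
  coefficient is multiplied by the numerator \<open>d\<^sup>s\<close>, the excess is harmless as long as it is at most \<open>s\<close>.
  So \<open>P\<^sub>n N - Q\<^sub>n d\<^sup>s\<close>, once the smaller denominator is cleared, is an integer. Whether it is zero or not,
  \<open>|E\<^sub>q(t) - d\<^sup>s/N|\<close> is at least a constant times \<open>|R\<^sub>n/Q\<^sub>n|\<close> when \<open>|R\<^sub>n|\<close> is slightly smaller than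
  \<open>1/|N p\<^bsup>n\<^sup>2 + ln\<^esup>|\<close>, so no zero estimate is needed. Up to terms linear in \<open>n\<close> one has
  \<open>s = n\<^sup>2/2 + ln\<close> and \<open>-log\<^sub>p |R\<^sub>n| = 3n\<^sup>2/2 + 2ln\<close>, and the largest admissible ratio \<open>l/n\<close> is
  \<open>1 + \<surd>3\<close>; this gives the exponent \<open>2 + 1/(3 + 2\<surd>3)\<close>.

  Any constant and any finite set of values of \<open>N\<close> can be absorbed into \<open>\<epsilon>\<^sub>2\<close>, since \<open>d\<^sup>s/N\<close> never equals
  \<open>E\<^sub>q(t)\<close>; hence \<open>C\<^sub>2 = 1\<close> will do.
\<close>

section \<open>The \<open>q\<close>-exponential function\<close>

text \<open>The bare bound \<open>1/4\<close> is not inductive; the extra term makes it so, because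
  \<open>(1/4 + y) * (1 - y) \<ge> 1/4 + y/2\<close> for \<open>0 \<le> y \<le> 1/4\<close>.\<close>

lemma prod_one_minus_half_powers_ge: "(\<Prod>i=1..Suc m. 1 - (1/2::real)^i) \<ge> 1/4 + (1/2)^(m+2)"
proof (induction m)
  case 0
  show ?case by (simp add: power2_eq_square)
next
  case (Suc m)
  define y :: real where "y = (1/2)^(m+2)"
  have y: "0 < y" "y \<le> 1/4"
    using power_decreasing[of 2 "m+2" "1/2::real"] by (simp_all add: y_def power2_eq_square)
  have "1/4 + y/2 \<le> (1/4 + y) * (1 - y)"
    using mult_left_mono[OF y(2), of y] y(1) by (simp add: field_simps)
  also have "\<dots> \<le> (\<Prod>i=1..Suc m. 1 - (1/2::real)^i) * (1 - y)"
    using Suc y by (intro mult_right_mono) (auto simp: y_def)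
  also have "\<dots> = (\<Prod>i=1..Suc (Suc m). 1 - (1/2::real)^i)"
    by (simp add: y_def)
  finally show ?case by (simp add: y_def)
qed

text \<open>Completing \<open>S\<close> to an initial segment only brings in factors between 0 and
  1.\<close>

lemma prod_one_minus_half_powers_ge_quarter:
  assumes "finite S" "0 \<notin> S"
  shows "(\<Prod>i\<in>S. 1 - (1/2::real)^i) \<ge> 1/4"
proof -
  obtain m where m: "S \<subseteq> {..m}"
    using assms(1) finite_nat_set_iff_bounded_le by auto
  have "S \<subseteq> {1..Suc m}"
  proof
    fix x assume "x \<in> S"
    with m assms(2) have "x \<le> m" "x \<noteq> 0" by (auto intro: ccontr)
    then show "x \<in> {1..Suc m}" by simp
  qed
  then have "(\<Prod>i=1..Suc m. 1 - (1/2::real)^i) =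
      (\<Prod>i\<in>{1..Suc m} - S. 1 - (1/2)^i) * (\<Prod>i\<in>S. 1 - (1/2)^i)"
    by (intro prod.subset_diff) auto
  also have "\<dots> \<le> 1 * (\<Prod>i\<in>S. 1 - (1/2)^i)"
    by (intro mult_right_mono prod_le_1 prod_nonneg) (auto simp: power_le_one)
  moreover have "(0::real) \<le> (1/2)^(m+2)" by simp
  ultimately show ?thesis
    using prod_one_minus_half_powers_ge[of m] by linarith
qed

lemma
  fixes q :: real
  assumes q: "\<bar>q\<bar> \<le> 1/2" and S: "finite S" "0 \<notin> S"
  shows abs_prod_one_minus_powers_ge: "\<bar>\<Prod>i\<in>S. 1 - q^i\<bar> \<ge> 1/4"
    and abs_prod_one_minus_powers_le: "\<bar>\<Prod>i\<in>S. 1 - q^i\<bar> \<le> 4"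
proof -
  have qi: "\<bar>q^i\<bar> \<le> (1/2)^i" for i
    using power_mono[OF q, of i] by (simp add: power_abs)
  have half: "(1/2::real)^i \<le> 1" for i by (simp add: power_le_one)
  have "(\<Prod>i\<in>S. 1 - (1/2::real)^i) \<le> (\<Prod>i\<in>S. \<bar>1 - q^i\<bar>)"
  proof (rule prod_mono)
    fix i
    show "0 \<le> 1 - (1/2::real)^i \<and> 1 - (1/2)^i \<le> \<bar>1 - q^i\<bar>"
      using qi[of i] half[of i] by linarith
  qed
  then show "\<bar>\<Prod>i\<in>S. 1 - q^i\<bar> \<ge> 1/4"
    using prod_one_minus_half_powers_ge_quarter[OF S] by (simp add: abs_prod)
  have "(\<Prod>i\<in>S. \<bar>1 - q^i\<bar>) \<le> (\<Prod>i\<in>S. 1 + (1/2::real)^i)"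
  proof (rule prod_mono)
    fix i
    show "0 \<le> \<bar>1 - q^i\<bar> \<and> \<bar>1 - q^i\<bar> \<le> 1 + (1/2)^i"
      using qi[of i] half[of i] by linarith
  qed
  moreover have "(\<Prod>i\<in>S. 1 + (1/2::real)^i) \<le> 4"
  proof -
    let ?a = "\<Prod>i\<in>S. 1 + (1/2::real)^i" and ?b = "\<Prod>i\<in>S. 1 - (1/2::real)^i"
    have "?a * ?b = (\<Prod>i\<in>S. (1 + (1/2::real)^i) * (1 - (1/2)^i))"
      by (simp add: prod.distrib)
    also have "\<dots> \<le> 1"
    proof (rule prod_le_1)
      fix i
      have "(1 + (1/2::real)^i) * (1 - (1/2)^i) = 1 - ((1/2)^i)\<^sup>2"
        by (simp add: algebra_simps power2_eq_square)
      then show "0 \<le> (1 + (1/2::real)^i) * (1 - (1/2)^i) \<and> (1 + (1/2::real)^i) * (1 - (1/2)^i) \<le> 1"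
        using half[of i] by (simp add: power_le_one)
    qed
    finally have "?a * ?b \<le> 1" .
    moreover have "?a \<ge> 0" by (intro prod_nonneg) simp
    then have "?a * (1/4) \<le> ?a * ?b"
      using prod_one_minus_half_powers_ge_quarter[OF S] by (intro mult_left_mono)
    ultimately show ?thesis by linarith
  qed
  ultimately show "\<bar>\<Prod>i\<in>S. 1 - q^i\<bar> \<le> 4"
    by (simp add: abs_prod)
qed

section \<open>Convergence, functional equation and size of the series\<close>

lemma q_exp_term_le:
  fixes q :: real
  assumes "\<bar>q\<bar> \<le> 1/2"
  shows "\<bar>t ^ k / (\<Prod>n=1..k. 1 - q ^ n)\<bar> \<le> 4 * \<bar>t\<bar> ^ k"
proof -
  have "\<bar>\<Prod>n=1..k. 1 - q ^ n\<bar> \<ge> 1/4"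
    using assms by (intro abs_prod_one_minus_powers_ge) auto
  then have "\<bar>t\<bar>^k / \<bar>\<Prod>n=1..k. 1 - q ^ n\<bar> \<le> \<bar>t\<bar>^k / (1/4)"
    by (intro divide_left_mono mult_pos_pos) (linarith | simp)+
  then show ?thesis by (simp add: abs_divide power_abs)
qed

lemma q_exp_sums:
  fixes q :: real
  assumes "\<bar>q\<bar> \<le> 1/2" "\<bar>t\<bar> < 1"
  shows "(\<lambda>k. t ^ k / (\<Prod>n=1..k. 1 - q ^ n)) sums q_exp q t"
proof -
  have "summable (\<lambda>k. 4 * \<bar>t\<bar> ^ k)"
    using assms by (intro summable_mult summable_geometric) auto
  then have "summable (\<lambda>k. t ^ k / (\<Prod>n=1..k. 1 - q ^ n))"
    by (rule summable_comparison_test'[where N = 0]) (simp only: real_norm_def q_exp_term_le[OF assms(1)])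
  then show ?thesis by (simp add: q_exp_def summable_sums)
qed

text \<open>Termwise, \<open>1 - q^(k+1)\<close> cancels the last factor of the denominator, so the
  series at \<open>t\<close> minus the series at \<open>q * t\<close> is \<open>t\<close> times the
  series at \<open>t\<close>.\<close>

lemma q_exp_mult:
  fixes q :: real
  assumes "\<bar>q\<bar> \<le> 1/2" "\<bar>t\<bar> < 1"
  shows "q_exp q (q * t) = (1 - t) * q_exp q t"
proof -
  let ?c = "\<lambda>k. \<Prod>n=1..k. 1 - q ^ n"
  have c: "?c k \<noteq> 0" for k
  proof -
    have "\<bar>?c k\<bar> \<ge> 1/4" by (rule abs_prod_one_minus_powers_ge[OF assms(1)]) auto
    then show ?thesis by linarith
  qed
  have qt: "\<bar>q * t\<bar> < 1"
    using assms mult_mono[of "\<bar>q\<bar>" "1/2" "\<bar>t\<bar>" 1] by (simp add: abs_mult)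
  have "(\<lambda>k. t ^ k / ?c k - (q * t) ^ k / ?c k) sums (q_exp q t - q_exp q (q * t))"
    by (intro sums_diff q_exp_sums assms qt)
  then have "(\<lambda>k. t ^ Suc k / ?c (Suc k) - (q * t) ^ Suc k / ?c (Suc k)) sums (q_exp q t - q_exp q (q * t))"
    by (subst sums_Suc_iff) simp
  moreover have "t ^ Suc k / ?c (Suc k) - (q * t) ^ Suc k / ?c (Suc k) = t * (t ^ k / ?c k)" for k
  proof -
    have "?c (Suc k) = ?c k * (1 - q ^ Suc k)" by simp
    moreover from this c[of "Suc k"] have "1 - q ^ Suc k \<noteq> 0" by auto
    moreover have "t ^ Suc k - (q * t) ^ Suc k = t * t ^ k * (1 - q ^ Suc k)"
      by (simp add: power_mult_distrib algebra_simps)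
    ultimately show ?thesis using c[of k]
      by (simp only: diff_divide_distrib[symmetric]) (simp add: field_simps)
  qed
  ultimately have "(\<lambda>k. t * (t ^ k / ?c k)) sums (q_exp q t - q_exp q (q * t))"
    by simp
  moreover have "(\<lambda>k. t * (t ^ k / ?c k)) sums (t * q_exp q t)"
    by (intro sums_mult q_exp_sums assms)
  ultimately have "q_exp q t - q_exp q (q * t) = t * q_exp q t"
    by (rule sums_unique2)
  then show ?thesis by (simp add: algebra_simps)
qed

lemma abs_q_power_mult_less_1:
  fixes q :: real
  assumes "\<bar>q\<bar> \<le> 1/2" "\<bar>t\<bar> < 1"
  shows "\<bar>q ^ l * t\<bar> < 1"
  using assms mult_mono[of "\<bar>q\<bar> ^ l" 1 "\<bar>t\<bar>" "\<bar>t\<bar>"]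
  by (simp add: abs_mult power_abs power_le_one)

lemma q_exp_power_mult:
  fixes q :: real
  assumes "\<bar>q\<bar> \<le> 1/2" "\<bar>t\<bar> < 1"
  shows "q_exp q (q ^ l * t) = (\<Prod>k<l. 1 - q ^ k * t) * q_exp q t"
proof (induction l)
  case (Suc l)
  show ?case
    using q_exp_mult[OF assms(1) abs_q_power_mult_less_1[OF assms, of l]] Suc
    by (simp add: algebra_simps)
qed simp

lemma abs_prod_one_minus_q_power_mult_le:
  fixes q :: real
  assumes "\<bar>q\<bar> \<le> 1/2" "\<bar>t\<bar> < 1"
  shows "\<bar>\<Prod>k<l. 1 - q ^ k * t\<bar> \<le> 2 ^ l"
proof -
  have "(\<Prod>k<l. \<bar>1 - q ^ k * t\<bar>) \<le> (\<Prod>k<l. 2)"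
  proof (rule prod_mono)
    fix k
    show "0 \<le> \<bar>1 - q ^ k * t\<bar> \<and> \<bar>1 - q ^ k * t\<bar> \<le> 2"
      using abs_q_power_mult_less_1[OF assms, of k] by linarith
  qed
  then show ?thesis by (simp add: abs_prod)
qed

lemma abs_q_exp_le:
  fixes q :: real
  assumes "\<bar>q\<bar> \<le> 1/2" "\<bar>t\<bar> < 1"
  shows "\<bar>q_exp q t\<bar> \<le> 4 / (1 - \<bar>t\<bar>)"
proof -
  have "(\<lambda>k. 4 * \<bar>t\<bar> ^ k) sums (4 * (1 / (1 - \<bar>t\<bar>)))"
    using assms by (intro sums_mult geometric_sums) auto
  from norm_sums_le[OF q_exp_sums[OF assms] this] show ?thesis
    using q_exp_term_le[OF assms(1)] by simp
qed

text \<open>At \<open>T = q^4 * t\<close> the argument is so small that the series is within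
  \<open>1/2\<close> of its constant term 1; going back to \<open>t\<close> by the functional
  equation costs a factor of at most \<open>2^4\<close>.\<close>

lemma abs_q_exp_ge:
  fixes q :: real
  assumes "\<bar>q\<bar> \<le> 1/2" "\<bar>t\<bar> < 1"
  shows "\<bar>q_exp q t\<bar> \<ge> 1/32"
proof -
  define T where "T = q ^ 4 * t"
  have "\<bar>q\<bar> ^ 4 \<le> (1/2) ^ 4" using assms by (intro power_mono) auto
  then have "\<bar>q\<bar> ^ 4 * \<bar>t\<bar> \<le> 1/16 * 1"
    using assms by (intro mult_mono) (auto simp: power4_eq_xxxx)
  then have T: "\<bar>T\<bar> \<le> 1/16" by (simp add: T_def abs_mult power_abs)
  have "(\<lambda>k. T ^ Suc k / (\<Prod>n=1..Suc k. 1 - q ^ n)) sums (q_exp q T - 1)"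
    using q_exp_sums[OF assms(1), of T] T by (subst sums_Suc_iff) simp
  moreover have "(\<lambda>k. 4 * \<bar>T\<bar> * \<bar>T\<bar> ^ k) sums (4 * \<bar>T\<bar> * (1 / (1 - \<bar>T\<bar>)))"
    using T by (intro sums_mult geometric_sums) auto
  ultimately have "norm (q_exp q T - 1) \<le> 4 * \<bar>T\<bar> * (1 / (1 - \<bar>T\<bar>))"
  proof (rule norm_sums_le)
    fix k
    show "norm (T ^ Suc k / (\<Prod>n=1..Suc k. 1 - q ^ n)) \<le> 4 * \<bar>T\<bar> * \<bar>T\<bar> ^ k"
      using q_exp_term_le[OF assms(1), of T "Suc k"] by (simp add: mult_ac)
  qed
  also have "\<dots> \<le> 1/2" using T by (simp add: field_simps)
  finally have "\<bar>q_exp q T\<bar> \<ge> 1/2" by (simp only: real_norm_def)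
  moreover have "\<bar>q_exp q T\<bar> = \<bar>\<Prod>k<4. 1 - q ^ k * t\<bar> * \<bar>q_exp q t\<bar>"
    unfolding T_def q_exp_power_mult[OF assms] by (simp add: abs_mult)
  moreover have "\<bar>\<Prod>k<4. 1 - q ^ k * t\<bar> * \<bar>q_exp q t\<bar> \<le> 2 ^ 4 * \<bar>q_exp q t\<bar>"
    by (intro mult_right_mono abs_prod_one_minus_q_power_mult_le assms) auto
  ultimately show ?thesis by simp
qed

section \<open>Pade approximants\<close>

text \<open>For \<open>n < k \<le> n + m\<close> one factor of the numerator vanishes. The diagonal
  approximants have \<open>m = n\<close>; general \<open>m\<close> permits induction.\<close>

definition pade_coeff :: "real \<Rightarrow> nat \<Rightarrow> nat \<Rightarrow> nat \<Rightarrow> real" where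
  "pade_coeff q n m k = (\<Prod>i=n+1..n+m. q ^ k - q ^ i) / (\<Prod>i=1..k. 1 - q ^ i)"

text \<open>
  The coefficients for \<open>m + 1\<close> arise from those for \<open>m\<close> by the factor \<open>q\<^sup>k - q\<^bsup>n+m+1\<^esup>\<close>, that is, by
  \<open>F(T) \<mapsto> F(qT) - q\<^bsup>n+m+1\<^esup> F(T)\<close> on generating functions; with the functional equation of \<open>E\<^sub>q\<close>
  this is the recursion below.
\<close>

fun pade_den :: "real \<Rightarrow> nat \<Rightarrow> nat \<Rightarrow> real \<Rightarrow> real" where
  "pade_den q n 0 T = 1"
| "pade_den q n (Suc m) T = (1 - T) * pade_den q n m (q * T) - q ^ (n + m + 1) * pade_den q n m T"

lemma pade_den_sums:
  assumes "\<bar>q\<bar> \<le> 1/2" "\<bar>T\<bar> < 1"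
  shows "(\<lambda>k. pade_coeff q n m k * T ^ k) sums (pade_den q n m T * q_exp q T)"
  using assms(2)
proof (induction m arbitrary: T)
  case 0
  then show ?case using q_exp_sums[OF assms(1), of T] by (simp add: pade_coeff_def)
next
  case (Suc m)
  have qT: "\<bar>q * T\<bar> < 1"
    using abs_q_power_mult_less_1[OF assms(1) Suc.prems, of 1] by simp
  have "(\<lambda>k. pade_coeff q n m k * (q * T) ^ k - q ^ (n + m + 1) * (pade_coeff q n m k * T ^ k)) sums
      (pade_den q n m (q * T) * q_exp q (q * T) - q ^ (n + m + 1) * (pade_den q n m T * q_exp q T))"
    by (intro sums_diff sums_mult Suc.IH qT Suc.prems)
  moreover have "pade_coeff q n m k * (q * T) ^ k - q ^ (n + m + 1) * (pade_coeff q n m k * T ^ k) =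
      pade_coeff q n (Suc m) k * T ^ k" for k
    by (simp add: pade_coeff_def power_mult_distrib algebra_simps flip: diff_divide_distrib)
  ultimately have "(\<lambda>k. pade_coeff q n (Suc m) k * T ^ k) sums
      (pade_den q n m (q * T) * q_exp q (q * T) - q ^ (n + m + 1) * (pade_den q n m T * q_exp q T))"
    by (simp only:)
  then show ?case
    unfolding q_exp_mult[OF assms(1) Suc.prems] by (simp add: algebra_simps)
qed

text \<open>A recursion step costs at most \<open>\<bar>1 - T\<bar> + 1 \<le> 3\<close>. A merely
  exponential bound is affordable: the decisive exponents are quadratic in \<open>n\<close>.\<close>

lemma abs_pade_den_le:
  assumes "\<bar>q\<bar> \<le> 1/2" "\<bar>T\<bar> < 1"
  shows "\<bar>pade_den q n m T\<bar> \<le> 3 ^ m"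
  using assms(2)
proof (induction m arbitrary: T)
  case (Suc m)
  have qT: "\<bar>q * T\<bar> < 1"
    using abs_q_power_mult_less_1[OF assms(1) Suc.prems, of 1] by simp
  have "\<bar>1 - T\<bar> * \<bar>pade_den q n m (q * T)\<bar> \<le> 2 * 3 ^ m"
    using Suc.prems Suc.IH[OF qT] by (intro mult_mono) auto
  moreover have "\<bar>q\<bar> ^ (n + m + 1) * \<bar>pade_den q n m T\<bar> \<le> 1 * 3 ^ m"
    using assms(1) Suc.IH[OF Suc.prems] by (intro mult_mono power_le_one) auto
  moreover have "\<bar>pade_den q n (Suc m) T\<bar> \<le>
      \<bar>1 - T\<bar> * \<bar>pade_den q n m (q * T)\<bar> + \<bar>q\<bar> ^ (n + m + 1) * \<bar>pade_den q n m T\<bar>"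
    using abs_triangle_ineq4[of "(1 - T) * pade_den q n m (q * T)" "q ^ (n + m + 1) * pade_den q n m T"]
    by (simp only: pade_den.simps abs_mult power_abs)
  ultimately show ?case by simp
qed simp

lemma Ints_of_int_mult: "x \<in> \<int> \<Longrightarrow> of_int a * x \<in> (\<int> :: 'a::ring_1 set)"
  by (intro Ints_mult) auto

section \<open>Integrality after clearing denominators\<close>

text \<open>The recursion moves \<open>T\<close> to \<open>q * T\<close>, that is \<open>l\<close>
  to \<open>l + 1\<close>, so \<open>l\<close> varies in the induction. From \<open>m\<close> to
  \<open>m + 1\<close> the exponent of \<open>d\<close> grows by \<open>l + m\<close>, which covers
  the factor \<open>q^(n+m+1)\<close> precisely when \<open>n + 1 \<le> l\<close>.\<close>

lemma pade_den_Ints: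
  fixes d u v :: int
  assumes "d \<noteq> 0" "v \<noteq> 0" "n + 1 \<le> l"
  shows "real_of_int d ^ ((m choose 2) + l * m) * real_of_int v ^ m *
           pade_den (1 / d) n m (u / (v * d ^ l)) \<in> \<int>"
  using assms(3)
proof (induction m arbitrary: l)
  case (Suc m)
  define T where "T = real_of_int u / (v * d ^ l)"
  let ?Q = "pade_den (1 / d) n m"
  have T: "1 / d * T = u / (v * d ^ Suc l)" by (simp add: T_def)
  \<comment> \<open>Relative to the induction hypothesis at \<open>l + 1\<close> there remains
    \<open>d^l\<close>, just enough to clear \<open>1 - T\<close>.\<close>
  have e1: "(Suc m choose 2) + l * Suc m = ((m choose 2) + Suc l * m) + l"
    by (simp add: numeral_2_eq_2)
  have e2: "(Suc m choose 2) + l * Suc m = ((m choose 2) + l * m) + (n + m + 1) + (l - (n + 1))"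
    using Suc.prems by (simp add: numeral_2_eq_2)
  have "real_of_int d ^ ((Suc m choose 2) + l * Suc m) * real_of_int v ^ Suc m * ((1 - T) * ?Q (1 / d * T))
      = of_int (v * d ^ l - u) *
        (real_of_int d ^ ((m choose 2) + Suc l * m) * real_of_int v ^ m * ?Q (u / (v * d ^ Suc l)))"
    unfolding T e1 power_add using assms(1,2) by (simp add: T_def field_simps)
  also have "\<dots> \<in> \<int>"
    by (intro Ints_of_int_mult Suc.IH) (use Suc.prems in simp)
  finally have 1: "real_of_int d ^ ((Suc m choose 2) + l * Suc m) * real_of_int v ^ Suc m *
      ((1 - T) * ?Q (1 / d * T)) \<in> \<int>" .
  have "real_of_int d ^ ((Suc m choose 2) + l * Suc m) * real_of_int v ^ Suc m * ((1 / d) ^ (n + m + 1) * ?Q T)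
      = of_int (v * d ^ (l - (n + 1))) * (real_of_int d ^ ((m choose 2) + l * m) * real_of_int v ^ m * ?Q T)"
    unfolding e2 power_add[of _ _ "n + m + 1"] power_add[of _ _ "l - (n + 1)"]
    using assms(1,2) by (simp add: power_divide)
  also have "\<dots> \<in> \<int>"
    unfolding T_def by (intro Ints_of_int_mult Suc.IH Suc.prems)
  finally have 2: "real_of_int d ^ ((Suc m choose 2) + l * Suc m) * real_of_int v ^ Suc m *
      ((1 / d) ^ (n + m + 1) * ?Q T) \<in> \<int>" .
  have "real_of_int d ^ ((Suc m choose 2) + l * Suc m) * real_of_int v ^ Suc m * pade_den (1 / d) n (Suc m) T \<in> \<int>"
    using Ints_diff[OF 1 2] by (simp only: pade_den.simps right_diff_distrib)
  then show ?case by (simp only: T_def)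
qed simp

lemma prod_one_minus_q_power_mult_Ints:
  fixes d u v :: int
  assumes "d \<noteq> 0" "v \<noteq> 0"
  shows "real_of_int d ^ (l choose 2) * real_of_int v ^ l * (\<Prod>k<l. 1 - (1 / d) ^ k * (u / v)) \<in> \<int>"
proof (induction l)
  case (Suc l)
  have e: "(Suc l choose 2) = (l choose 2) + l" by (simp add: numeral_2_eq_2)
  have "real_of_int d ^ (Suc l choose 2) * real_of_int v ^ Suc l * (\<Prod>k<Suc l. 1 - (1 / d) ^ k * (u / v))
      = of_int (v * d ^ l - u) *
        (real_of_int d ^ (l choose 2) * real_of_int v ^ l * (\<Prod>k<l. 1 - (1 / d) ^ k * (u / v)))"
    unfolding e power_add using assms by (simp add: field_simps)
  also have "\<dots> \<in> \<int>" by (intro Ints_of_int_mult Suc.IH)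
  finally show ?case .
qed simp

text \<open>The divisibility behind the integrality of Gaussian binomial coefficients.\<close>

lemma prod_power_minus_one_dvd:
  fixes d :: "'a::comm_ring_1"
  shows "(\<Prod>i=1..k. d ^ i - 1) dvd (\<Prod>i=a+1..a+k. d ^ i - 1)"
proof (induction k arbitrary: a)
  case (Suc k)
  note IH = Suc
  show ?case
  proof (induction a)
    case (Suc a)
    let ?W = "\<lambda>a k. \<Prod>i=a+1..a+k. d ^ i - 1"
    have 1: "?W (Suc a) (Suc k) = ?W (Suc a) k * (d ^ (a + k + 2) - 1)" by simp
    have 2: "?W a (Suc k) = (d ^ (a + 1) - 1) * ?W (Suc a) k"
      by (subst prod.atLeast_Suc_atMost) simp_all
    \<comment> \<open>A form of the q-Pascal rule, from
      \<open>d^(a+k+2) - 1 = d^(k+1) * (d^(a+1) - 1) + (d^(k+1) - 1)\<close>. The inner induction on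
      \<open>a\<close> handles the first summand, the outer one on \<open>k\<close> the
      second.\<close>
    have "?W (Suc a) (Suc k) = d ^ (k + 1) * ?W a (Suc k) + ?W (Suc a) k * (d ^ (k + 1) - 1)"
      unfolding 1 2 by (simp add: algebra_simps power_add)
    moreover have "(\<Prod>i=1..Suc k. d ^ i - 1) dvd ?W (Suc a) k * (d ^ (k + 1) - 1)"
      using mult_dvd_mono[OF IH[of "Suc a"] dvd_refl[of "d ^ (k + 1) - 1"]] by simp
    ultimately show ?case using Suc by (metis dvd_add dvd_mult)
  qed simp
qed simp

lemma double_sum_consecutive: "2 * (\<Sum>i=n+1..n+m. i) = m * (2 * n + m + 1)" for n m :: nat
  by (induction m) (simp_all add: algebra_simps)

text \<open>Pulling the powers of \<open>1/d\<close> out of numerator and denominator leaves the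
  integer products \<open>W\<close> and \<open>V\<close>. The first \<open>k\<close> factors of
  \<open>W\<close> are consecutive, so \<open>V\<close> divides \<open>W\<close>, and only powers of
  \<open>d\<close> and \<open>v\<close> remain to be compared.\<close>

lemma pade_coeff_Ints:
  fixes d u v :: int
  assumes d: "\<bar>d\<bar> \<ge> 2" and v: "v \<noteq> 0" and k: "k \<le> n" and l: "n \<le> l"
  shows "real_of_int d ^ (n * n + l * n) * real_of_int v ^ n *
           (pade_coeff (1 / d) n n k * (u / (v * d ^ l)) ^ k) \<in> \<int>"
proof -
  define W V where "W = (\<Prod>i=n-k+1..n-k+n. d ^ i - 1)" and "V = (\<Prod>i=1..k. d ^ i - 1)"
  define A B where "A = (\<Sum>i=n+1..n+n. i)" and "B = (\<Sum>i=1..k. i)"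
  have d0: "d \<noteq> 0" using d by auto
  have "d ^ i \<noteq> 1" if "i \<in> {1..k}" for i
  proof
    assume "d ^ i = 1"
    then have "\<bar>d\<bar> ^ i = 1" by (simp flip: power_abs)
    moreover have "\<bar>d\<bar> ^ i > 1" using d that by (intro one_less_power) auto
    ultimately show False by simp
  qed
  then have V: "V \<noteq> 0" by (auto simp: V_def)
  have "V dvd (\<Prod>i=n-k+1..n-k+k. d ^ i - 1)"
    unfolding V_def by (rule prod_power_minus_one_dvd)
  also have "\<dots> dvd W"
    unfolding W_def using k by (intro prod_dvd_prod_subset) auto
  finally obtain w where w: "W = V * w" by (elim dvdE)
  have "(\<Prod>i=n+1..n+n. (1 / real_of_int d) ^ k - (1 / d) ^ i)
      = (\<Prod>i=n+1..n+n. (1 / real_of_int d) ^ i * of_int (d ^ (i - k) - 1))"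
  proof (rule prod.cong)
    fix i assume "i \<in> {n+1..n+n}"
    then have "i = (i - k) + k" using k by simp
    then have "real_of_int d ^ i = real_of_int d ^ (i - k) * real_of_int d ^ k" by (metis power_add)
    then show "(1 / real_of_int d) ^ k - (1 / d) ^ i = (1 / real_of_int d) ^ i * of_int (d ^ (i - k) - 1)"
      using d0 by (simp add: power_divide field_simps)
  qed simp
  also have "\<dots> = (1 / real_of_int d) ^ A * of_int (\<Prod>i=n+1..n+n. d ^ (i - k) - 1)"
    by (simp add: prod.distrib power_sum A_def)
  also have "(\<Prod>i=n+1..n+n. d ^ (i - k) - 1) = W"
    unfolding W_def
    by (rule prod.reindex_bij_witness[where j = "\<lambda>i. i - k" and i = "\<lambda>i. i + k"]) (use k in auto)
  finally have num: "(\<Prod>i=n+1..n+n. (1 / real_of_int d) ^ k - (1 / d) ^ i)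
      = (1 / real_of_int d) ^ A * (of_int V * of_int w)" by (simp add: w)
  have "(\<Prod>i=1..k. 1 - (1 / real_of_int d) ^ i) = (\<Prod>i=1..k. (1 / real_of_int d) ^ i * of_int (d ^ i - 1))"
    using d0 by (intro prod.cong) (simp_all add: power_divide field_simps)
  also have "\<dots> = (1 / real_of_int d) ^ B * of_int V"
    by (simp add: prod.distrib power_sum B_def V_def)
  finally have den: "(\<Prod>i=1..k. 1 - (1 / real_of_int d) ^ i) = (1 / real_of_int d) ^ B * of_int V" .
  have coeff: "pade_coeff (1 / d) n n k = d ^ B * w / d ^ A"
    unfolding pade_coeff_def num den using V d0 by (simp add: power_divide field_simps)
  \<comment> \<open>The critical index is \<open>k = n\<close>, where equality holds; with
    \<open>r = n - k\<close>, twice the slack is \<open>r * (2 * l - (n + k + 1))\<close>.\<close>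
  have "A + l * k \<le> n * n + l * n + B"
  proof -
    have "2 * A = n * (2 * n + n + 1)" "2 * B = k * (k + 1)"
      using double_sum_consecutive[of n n] double_sum_consecutive[of 0 k]
      by (simp_all add: A_def B_def)
    moreover obtain r where r: "n = k + r" using k le_Suc_ex by blast
    have "r * (n + k + 1) \<le> 2 * l * r"
    proof (cases "r = 0")
      case False
      then have "n + k + 1 \<le> 2 * l" using r l by linarith
      then have "(n + k + 1) * r \<le> 2 * l * r" by (rule mult_le_mono1)
      then show ?thesis by (simp only: mult.commute)
    qed simp
    ultimately have "2 * (A + l * k) \<le> 2 * (n * n + l * n + B)"
      unfolding r by (simp add: algebra_simps)
    then show ?thesis by simp
  qed
  then obtain e where e: "n * n + l * n + B = A + l * k + e" using le_Suc_ex by blast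
  have "real_of_int d ^ (n * n + l * n) * real_of_int v ^ n * (pade_coeff (1 / d) n n k * (u / (v * d ^ l)) ^ k)
      = real_of_int d ^ (n * n + l * n + B) * w * u ^ k * (real_of_int v ^ n / real_of_int v ^ k) /
        (d ^ A * d ^ (l * k))"
    unfolding coeff by (simp add: power_divide power_mult_distrib power_add mult_ac flip: power_mult)
  also have "\<dots> = of_int (d ^ e * w * u ^ k * v ^ (n - k))"
    unfolding e using d0 v k by (simp add: power_add flip: power_diff)
  finally show ?thesis by (simp only: Ints_of_int)
qed

section \<open>Size of the remainder\<close>

lemma pade_coeff_eq_0: "n < k \<Longrightarrow> k \<le> n + m \<Longrightarrow> pade_coeff q n m k = 0"
  by (auto simp: pade_coeff_def intro!: prod_zero)

text \<open>For \<open>i \<le> n + m < k\<close>, \<open>q^k - q^i = - q^i * (1 - q^(k-i))\<close>.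
  Apart from the powers \<open>q^i\<close>, a quotient of two products remains, each between
  \<open>1/4\<close> and \<open>4\<close> in absolute value.\<close>

lemma
  assumes q: "\<bar>q\<bar> \<le> 1/2" and k: "n + m < k"
  shows abs_pade_coeff_ge: "\<bar>q\<bar> ^ (\<Sum>i=n+1..n+m. i) / 16 \<le> \<bar>pade_coeff q n m k\<bar>"
    and abs_pade_coeff_le: "\<bar>pade_coeff q n m k\<bar> \<le> 16 * \<bar>q\<bar> ^ (\<Sum>i=n+1..n+m. i)"
proof -
  define Z where "Z = \<bar>q\<bar> ^ (\<Sum>i=n+1..n+m. i)"
  define S where "S = (\<lambda>i. k - i) ` {n+1..n+m}"
  define a b where "a = \<bar>\<Prod>i\<in>S. 1 - q ^ i\<bar>" and "b = \<bar>\<Prod>i=1..k. 1 - q ^ i\<bar>"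
  have S: "finite S" "0 \<notin> S" using k by (auto simp: S_def)
  have inj: "inj_on (\<lambda>i. k - i) {n+1..n+m}" using k by (auto simp: inj_on_def)
  have "(\<Prod>i=n+1..n+m. q ^ k - q ^ i) = (\<Prod>i=n+1..n+m. - (q ^ i) * (1 - q ^ (k - i)))"
    using k by (intro prod.cong) (simp_all add: algebra_simps flip: power_add)
  then have "\<bar>\<Prod>i=n+1..n+m. q ^ k - q ^ i\<bar> = Z * a"
    unfolding a_def S_def Z_def prod.reindex[OF inj]
    by (simp add: abs_prod abs_mult prod.distrib power_sum power_abs)
  then have eq: "\<bar>pade_coeff q n m k\<bar> = Z * (a / b)"
    by (simp add: pade_coeff_def b_def)
  have ab: "1/4 \<le> a" "a \<le> 4" "1/4 \<le> b" "b \<le> 4"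
    unfolding a_def b_def
    by (intro abs_prod_one_minus_powers_ge abs_prod_one_minus_powers_le q S; simp)+
  then have "1/16 \<le> a / b" "a / b \<le> 16" by (simp_all add: field_simps)
  then have "Z * (1/16) \<le> Z * (a / b)" "Z * (a / b) \<le> Z * 16"
    by (intro mult_left_mono; simp add: Z_def)+
  then show "Z / 16 \<le> \<bar>pade_coeff q n m k\<bar>" "\<bar>pade_coeff q n m k\<bar> \<le> 16 * Z"
    unfolding eq by simp_all
qed

text \<open>The term of index \<open>n + m + 1\<close> dominates: it lies between
  \<open>Z / 16\<close> and \<open>16 * Z\<close> in absolute value, while the later terms add up to
  at most \<open>Z / 32\<close> because \<open>T\<close> is small. The bound from below shows that
  the remainder does not vanish for nonzero \<open>q\<close> and \<open>T\<close>.\<close>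

lemma pade_remainder_bounds:
  fixes n m :: nat
  assumes q: "\<bar>q\<bar> \<le> 1/2" and T: "\<bar>T\<bar> \<le> 1/1024"
  defines "Z \<equiv> \<bar>q\<bar> ^ (\<Sum>i=n+1..n+m. i) * \<bar>T\<bar> ^ (n + m + 1)"
    and "R \<equiv> pade_den q n m T * q_exp q T - (\<Sum>k\<le>n. pade_coeff q n m k * T ^ k)"
  shows "Z / 32 \<le> \<bar>R\<bar>" "\<bar>R\<bar> \<le> 32 * Z"
proof -
  let ?f = "\<lambda>k. pade_coeff q n m k * T ^ k"
  let ?K = "n + m + 2"
  have Z: "Z \<ge> 0" by (simp add: Z_def)
  have "(\<Sum>k<?K. ?f k) = (\<Sum>k<n + m + 1. ?f k) + ?f (n + m + 1)" by simp
  also have "(\<Sum>k<n + m + 1. ?f k) = (\<Sum>k\<le>n. ?f k)"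
    by (rule sum.mono_neutral_right) (auto simp: pade_coeff_eq_0)
  finally have "(\<lambda>k. ?f (k + ?K)) sums (R - ?f (n + m + 1))"
    using sums_split_initial_segment[OF pade_den_sums[OF q, of T n m], of ?K] T by (simp add: R_def diff_diff_add)
  moreover have "(\<lambda>k. 16 * Z * \<bar>T\<bar> * \<bar>T\<bar> ^ k) sums (16 * Z * \<bar>T\<bar> * (1 / (1 - \<bar>T\<bar>)))"
    using T by (intro sums_mult geometric_sums) auto
  ultimately have "norm (R - ?f (n + m + 1)) \<le> 16 * Z * \<bar>T\<bar> * (1 / (1 - \<bar>T\<bar>))"
  proof (rule norm_sums_le)
    fix k
    have "\<bar>pade_coeff q n m (k + ?K)\<bar> * \<bar>T\<bar> ^ (k + ?K) \<le>
        16 * \<bar>q\<bar> ^ (\<Sum>i=n+1..n+m. i) * \<bar>T\<bar> ^ (k + ?K)"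
      by (intro mult_right_mono abs_pade_coeff_le q) auto
    then show "norm (?f (k + ?K)) \<le> 16 * Z * \<bar>T\<bar> * \<bar>T\<bar> ^ k"
      by (simp add: Z_def abs_mult power_abs power_add mult_ac)
  qed
  also have "\<dots> = Z * (16 * \<bar>T\<bar> / (1 - \<bar>T\<bar>))" by simp
  also have "\<dots> \<le> Z * (1/32)"
    using T by (intro mult_left_mono Z) (simp add: field_simps)
  finally have 1: "\<bar>R - ?f (n + m + 1)\<bar> \<le> Z / 32" by simp
  have "\<bar>q\<bar> ^ (\<Sum>i=n+1..n+m. i) / 16 * \<bar>T\<bar> ^ (n + m + 1) \<le>
      \<bar>pade_coeff q n m (n + m + 1)\<bar> * \<bar>T\<bar> ^ (n + m + 1)"
    by (intro mult_right_mono abs_pade_coeff_ge q) auto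
  moreover have "\<bar>pade_coeff q n m (n + m + 1)\<bar> * \<bar>T\<bar> ^ (n + m + 1) \<le>
      16 * \<bar>q\<bar> ^ (\<Sum>i=n+1..n+m. i) * \<bar>T\<bar> ^ (n + m + 1)"
    by (intro mult_right_mono abs_pade_coeff_le q) auto
  ultimately have "Z / 16 \<le> \<bar>?f (n + m + 1)\<bar>" "\<bar>?f (n + m + 1)\<bar> \<le> 16 * Z"
    by (simp_all add: Z_def abs_mult power_abs)
  with 1 Z show "Z / 32 \<le> \<bar>R\<bar>" "\<bar>R\<bar> \<le> 32 * Z" by linarith+
qed

section \<open>The lower bound\<close>

text \<open>One has \<open>Q * (E - x) = R + J / (M * N)\<close> with an integer \<open>J\<close>.
  The assumption \<open>s\<close> makes \<open>d^s\<close> pay for the denominators of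
  \<open>Q\<close>, and \<open>big\<close> makes \<open>1 / \<bar>M * N\<bar>\<close> at least twice
  the upper bound for \<open>\<bar>R\<bar>\<close>. The assumption \<open>10 \<le> l\<close> yields
  \<open>\<bar>T\<bar> \<le> 1/1024\<close>.\<close>

lemma q_exp_approx_core:
  fixes d u v N :: int
  assumes d: "\<bar>d\<bar> \<ge> 2" and v: "v > 0" and u: "u \<noteq> 0" "\<bar>u\<bar> < v" and N: "N \<noteq> 0"
    and l: "n + 1 \<le> l" "10 \<le> l"
    and s: "(n + l choose 2) \<le> s + n * n + l * n"
    and big: "64 * real_of_int \<bar>N\<bar> * real_of_int v ^ (n + l) * real_of_int \<bar>d\<bar> ^ (n * n + l * n)
              \<le> real_of_int \<bar>d\<bar> ^ ((\<Sum>i=n+1..n+n. i) + l * (2 * n + 1))"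
  shows "1 / (32 * 3 ^ n * 2 ^ l * real_of_int v ^ (2 * n + 1) *
            real_of_int \<bar>d\<bar> ^ ((\<Sum>i=n+1..n+n. i) + l * (2 * n + 1)))
         \<le> \<bar>q_exp (1 / d) (u / v) - real_of_int d ^ s / N\<bar>"
proof -
  define q t T where "q = 1 / real_of_int d" and "t = real_of_int u / v"
    and "T = real_of_int u / (v * d ^ l)"
  define X where "X = real_of_int \<bar>d\<bar> ^ ((\<Sum>i=n+1..n+n. i) + l * (2 * n + 1))"
  define Z where "Z = \<bar>q\<bar> ^ (\<Sum>i=n+1..n+n. i) * \<bar>T\<bar> ^ (n + n + 1)"
  define Q where "Q = pade_den q n n T * (\<Prod>k<l. 1 - q ^ k * t)"
  define P where "P = (\<Sum>k\<le>n. pade_coeff q n n k * T ^ k)"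
  define R where "R = pade_den q n n T * q_exp q T - P"
  define E where "E = q_exp q t"
  define x where "x = real_of_int d ^ s / N"
  \<comment> \<open>\<open>M\<close> clears the denominators of \<open>P\<close> only; those of
    \<open>Q\<close> are cleared with the help of the factor \<open>d^s\<close> in
    \<open>J\<close>.\<close>
  define M where "M = real_of_int v ^ (n + l) * real_of_int d ^ (n * n + l * n)"
  define J where "J = M * (P * N - Q * d ^ s)"
  have d0: "d \<noteq> 0" and dr: "\<bar>real_of_int d\<bar> \<ge> 2" using d by linarith+
  have q: "\<bar>q\<bar> \<le> 1/2" using dr by (simp add: q_def abs_divide field_simps)
  have t: "\<bar>t\<bar> < 1" using u(2) v by (simp add: t_def abs_divide)
  have Tq: "T = q ^ l * t" by (simp add: T_def q_def t_def power_divide)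
  have "\<bar>q\<bar> ^ l \<le> (1/2) ^ l" using q by (intro power_mono) auto
  also have "\<dots> \<le> (1/2) ^ 10" using l(2) by (intro power_decreasing) auto
  finally have "\<bar>q\<bar> ^ l * \<bar>t\<bar> \<le> (1/2) ^ 10 * 1" using t by (intro mult_mono) auto
  then have T: "\<bar>T\<bar> \<le> 1/1024" by (simp add: Tq abs_mult power_abs power_divide)
  have R: "Z / 32 \<le> \<bar>R\<bar>" "\<bar>R\<bar> \<le> 32 * Z"
    unfolding R_def P_def Z_def by (rule pade_remainder_bounds[OF q T])+
  have X: "X > 0" using d0 by (simp add: X_def)
  have Z_eq: "Z = \<bar>t\<bar> ^ (2 * n + 1) / X"
    by (simp add: Z_def X_def q_def Tq abs_mult abs_divide power_abs power_divide power_mult_distrib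
        mult_2 power_add power_mult)
  have "\<bar>t\<bar> \<ge> 1 / v" using u(1) v by (simp add: t_def abs_divide divide_right_mono)
  then have "(1 / v) ^ (2 * n + 1) \<le> \<bar>t\<bar> ^ (2 * n + 1)" using v by (intro power_mono) auto
  then have Z_ge: "1 / (real_of_int v ^ (2 * n + 1) * X) \<le> Z"
    unfolding Z_eq using X by (simp add: power_divide field_simps)
  have "\<bar>t\<bar> ^ (2 * n + 1) \<le> 1" using t by (intro power_le_one) auto
  then have Z_le: "Z \<le> 1 / X" unfolding Z_eq using X by (intro divide_right_mono) auto
  have QE: "Q * E = P + R"
    using q_exp_power_mult[OF q t, of l] by (simp add: Q_def E_def R_def Tq mult_ac)
  have Q: "\<bar>Q\<bar> \<le> 3 ^ n * 2 ^ l"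
    unfolding Q_def abs_mult using T
    by (intro mult_mono abs_pade_den_le abs_prod_one_minus_q_power_mult_le q t) auto
  have M: "M \<noteq> 0" using v d0 by (simp add: M_def)
  have "J \<in> \<int>"
  proof -
    have "real_of_int d ^ (n * n + l * n) * real_of_int v ^ n * P \<in> \<int>"
      unfolding P_def sum_distrib_left q_def T_def
      by (rule Ints_sum) (use d v l in \<open>intro pade_coeff_Ints; simp\<close>)
    then have "of_int (v ^ l * N) * (real_of_int d ^ (n * n + l * n) * real_of_int v ^ n * P) \<in> \<int>"
      by (rule Ints_of_int_mult)
    also have "of_int (v ^ l * N) * (real_of_int d ^ (n * n + l * n) * real_of_int v ^ n * P) = M * (P * N)"
      by (simp add: M_def power_add)
    finally have 1: "M * (P * N) \<in> \<int>" .
    \<comment> \<open>The three summands are the exponents needed by \<open>pade_den\<close> (the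
      first two) and by the product over \<open>k < l\<close> (the last).\<close>
    have e: "(n + l choose 2) = (n choose 2) + l * n + (l choose 2)"
      by (induction n) (simp_all add: numeral_2_eq_2)
    then obtain r where r: "s + n * n + l * n = (n choose 2) + l * n + (l choose 2) + r"
      using s le_Suc_ex by metis
    have "M * (Q * d ^ s) = real_of_int v ^ (n + l) * real_of_int d ^ (s + n * n + l * n) * Q"
      by (simp add: M_def power_add)
    also have "\<dots> = of_int (d ^ r) *
        ((real_of_int d ^ ((n choose 2) + l * n) * real_of_int v ^ n * pade_den q n n T) *
         (real_of_int d ^ (l choose 2) * real_of_int v ^ l * (\<Prod>k<l. 1 - q ^ k * t)))"
      unfolding r Q_def by (simp add: power_add)
    also have "\<dots> \<in> \<int>"
      unfolding q_def T_def t_def using d0 v l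
      by (intro Ints_mult pade_den_Ints prod_one_minus_q_power_mult_Ints) auto
    finally show ?thesis using 1 by (simp add: J_def right_diff_distrib)
  qed
  have "P - Q * x = J / (M * N)" using N M by (simp add: J_def x_def field_simps)
  then have Qx: "Q * (E - x) = R + J / (M * N)" using QE by (simp add: algebra_simps)
  \<comment> \<open>If \<open>J = 0\<close>, the two sides agree. Otherwise
    \<open>J / (M * N)\<close> has size at least \<open>64 / X\<close>, while
    \<open>\<bar>R\<bar> \<le> 32 / X\<close>, so it cannot be cancelled below
    \<open>\<bar>R\<bar>\<close>.\<close>
  have "\<bar>R\<bar> \<le> \<bar>Q * (E - x)\<bar>"
  proof (cases "J = 0")
    case False
    then have "\<bar>J\<bar> \<ge> 1" using \<open>J \<in> \<int>\<close> by (auto elim!: Ints_cases)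
    have "64 * (\<bar>M\<bar> * \<bar>real_of_int N\<bar>) \<le> X"
      using big v by (simp add: M_def X_def abs_mult power_abs mult_ac)
    then have "64 / X \<le> 1 / (\<bar>M\<bar> * \<bar>real_of_int N\<bar>)"
      using X M N by (simp add: field_simps)
    also have "\<dots> \<le> \<bar>J\<bar> / (\<bar>M\<bar> * \<bar>real_of_int N\<bar>)"
      using \<open>\<bar>J\<bar> \<ge> 1\<close> by (intro divide_right_mono) auto
    finally have "64 / X \<le> \<bar>J / (M * N)\<bar>" by (simp add: abs_mult)
    moreover have "\<bar>R\<bar> \<le> 32 / X" using R(2) Z_le by simp
    ultimately show ?thesis unfolding Qx by linarith
  qed (simp add: Qx)
  also have "\<dots> \<le> 3 ^ n * 2 ^ l * \<bar>E - x\<bar>"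
    unfolding abs_mult by (intro mult_right_mono Q) auto
  finally have "Z / 32 \<le> 3 ^ n * 2 ^ l * \<bar>E - x\<bar>"
    using R(1) by (rule order_trans[rotated])
  moreover have "1 / (real_of_int v ^ (2 * n + 1) * X) / 32 \<le> Z / 32"
    using Z_ge by (rule divide_right_mono) simp
  ultimately have "1 / (real_of_int v ^ (2 * n + 1) * X) / 32 \<le> 3 ^ n * 2 ^ l * \<bar>E - x\<bar>"
    by (rule order_trans[rotated])
  then have "1 / (32 * 3 ^ n * 2 ^ l * real_of_int v ^ (2 * n + 1) * X) \<le> \<bar>E - x\<bar>"
    using X v by (simp add: field_simps)
  then show ?thesis by (simp add: X_def E_def x_def q_def t_def)
qed

section \<open>Choice of \<open>n\<close> and \<open>l\<close> for given \<open>s\<close>\<close>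

lemma real_choose_two: "real (m choose 2) = real m * (real m - 1) / 2"
  by (induction m) (simp_all add: numeral_2_eq_2 field_simps)

lemma real_sum_consecutive: "real (\<Sum>i=n+1..n+n. i) = (3 * real n * real n + real n) / 2"
proof -
  have "real (2 * (\<Sum>i=n+1..n+n. i)) = real (n * (2 * n + n + 1))"
    by (simp only: double_sum_consecutive)
  then have "2 * real (\<Sum>i=n+1..n+n. i) = real n * (2 * real n + real n + 1)"
    by (simp only: of_nat_mult of_nat_add of_nat_numeral of_nat_1)
  then show ?thesis by (simp add: algebra_simps)
qed

text \<open>Serves the choice of \<open>n\<close> near \<open>\<kappa> * sqrt s\<close> and
  \<open>l\<close> near \<open>\<mu> * n\<close>; each rounding changes a quotient by at most
  \<open>1 / sqrt s\<close>.\<close>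

lemma tendsto_ceiling_mult_sqrt:
  assumes "\<kappa> > 0" and \<mu>: "\<mu> > 0"
  shows "(\<lambda>s. real (nat \<lceil>\<kappa> * sqrt (real s)\<rceil>) / sqrt (real s)) \<longlonglongrightarrow> \<kappa>"
    and "(\<lambda>s. real (nat \<lfloor>\<mu> * real (nat \<lceil>\<kappa> * sqrt (real s)\<rceil>)\<rfloor>) / sqrt (real s)) \<longlonglongrightarrow> \<mu> * \<kappa>"
    and "(\<lambda>s. 1 / sqrt (real s)) \<longlonglongrightarrow> 0"
proof -
  let ?n = "\<lambda>s. real (nat \<lceil>\<kappa> * sqrt (real s)\<rceil>)"
  have "filterlim (\<lambda>s. sqrt (real s)) at_top sequentially"
    by (rule filterlim_compose[OF sqrt_at_top filterlim_real_sequentially])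
  then show c: "(\<lambda>s. 1 / sqrt (real s)) \<longlonglongrightarrow> 0"
    by (simp add: divide_inverse tendsto_inverse_0_at_top)
  have pos: "\<forall>\<^sub>F s in sequentially. sqrt (real s) > 0"
    using eventually_gt_at_top[of 0] by eventually_elim simp
  show a: "(\<lambda>s. ?n s / sqrt (real s)) \<longlonglongrightarrow> \<kappa>"
  proof (rule tendsto_sandwich)
    show "(\<lambda>s. \<kappa>) \<longlonglongrightarrow> \<kappa>" by simp
    show "(\<lambda>s. \<kappa> + 1 / sqrt (real s)) \<longlonglongrightarrow> \<kappa>"
      using tendsto_add[OF tendsto_const[of \<kappa>] c] by simp
    show "\<forall>\<^sub>F s in sequentially. \<kappa> \<le> ?n s / sqrt (real s)"
      using pos
    proof eventually_elim
      case (elim s)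
      have "\<kappa> * sqrt (real s) \<le> ?n s" by linarith
      then show ?case using elim by (simp add: field_simps)
    qed
    show "\<forall>\<^sub>F s in sequentially. ?n s / sqrt (real s) \<le> \<kappa> + 1 / sqrt (real s)"
      using pos
    proof eventually_elim
      case (elim s)
      have "0 < \<kappa> * sqrt (real s)" using assms elim by simp
      then have "?n s \<le> \<kappa> * sqrt (real s) + 1" by linarith
      then show ?case using elim by (simp add: field_simps)
    qed
  qed
  show "(\<lambda>s. real (nat \<lfloor>\<mu> * ?n s\<rfloor>) / sqrt (real s)) \<longlonglongrightarrow> \<mu> * \<kappa>"
  proof (rule tendsto_sandwich)
    show "(\<lambda>s. \<mu> * (?n s / sqrt (real s)) - 1 / sqrt (real s)) \<longlonglongrightarrow> \<mu> * \<kappa>"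
      using tendsto_diff[OF tendsto_mult[OF tendsto_const[of \<mu>] a] c] by simp
    show "(\<lambda>s. \<mu> * (?n s / sqrt (real s))) \<longlonglongrightarrow> \<mu> * \<kappa>"
      by (intro tendsto_intros a)
    show "\<forall>\<^sub>F s in sequentially. real (nat \<lfloor>\<mu> * ?n s\<rfloor>) / sqrt (real s) \<le> \<mu> * (?n s / sqrt (real s))"
      using pos
    proof eventually_elim
      case (elim s)
      have "0 \<le> \<mu> * ?n s" using \<mu> by simp
      then have "real (nat \<lfloor>\<mu> * ?n s\<rfloor>) \<le> \<mu> * ?n s" by linarith
      then show ?case using elim by (simp add: field_simps)
    qed
    show "\<forall>\<^sub>F s in sequentially. \<mu> * (?n s / sqrt (real s)) - 1 / sqrt (real s) \<le> real (nat \<lfloor>\<mu> * ?n s\<rfloor>) / sqrt (real s)"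
      using pos
    proof eventually_elim
      case (elim s)
      have "\<mu> * ?n s - 1 \<le> real (nat \<lfloor>\<mu> * ?n s\<rfloor>)" by linarith
      then have "(\<mu> * ?n s - 1) / sqrt (real s) \<le> real (nat \<lfloor>\<mu> * ?n s\<rfloor>) / sqrt (real s)"
        using elim by (intro divide_right_mono) auto
      then show ?case by (simp add: diff_divide_distrib)
    qed
  qed
qed

text \<open>With \<open>n\<close> near \<open>\<kappa> * sqrt s\<close>, \<open>l\<close> near
  \<open>\<mu> * n\<close> and \<open>e\<close> the target exponent, the last three inequalities
  become, to leading order, \<open>\<kappa>^2 * (\<mu>^2 - 1) < 2\<close>,
  \<open>\<kappa>^2 * (1 + 2*\<mu>) > 2\<close> and \<open>\<kappa>^2 * (3 + 4*\<mu>) < 2*e\<close>.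
  They are compatible if \<open>\<mu>^2 - 1 < 1 + 2*\<mu>\<close>, that is
  \<open>\<mu> < 1 + sqrt 3\<close>, and \<open>2 + 1/(1 + 2*\<mu>) < e\<close>. The lower order
  terms absorb powers of \<open>v\<close>, through \<open>v \<le> \<bar>d\<bar>^w\<close>, and
  numerical constants.\<close>

lemma eventually_pade_parameters:
  fixes \<epsilon> :: real and w :: nat
  assumes "\<epsilon> > 0"
  shows "\<forall>\<^sub>F s in sequentially. \<exists>n l. n + 1 \<le> l \<and> 10 \<le> l \<and> (n + l choose 2) \<le> s + n * n + l * n \<and>
    12 + s + w * (n + l) + (n * n + l * n) \<le> (\<Sum>i=n+1..n+n. i) + l * (2 * n + 1) \<and>
    real ((\<Sum>i=n+1..n+n. i) + l * (2 * n + 1) + w * (2 * n + 1) + 5 + 2 * n + l)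
      \<le> (2 + 1 / (3 + 2 * sqrt 3) + \<epsilon>) * (real s - real (4 * w + 1))"
proof -
  define \<Lambda> where "\<Lambda> = 1 + sqrt (3::real)"
  define e where "e = 2 + 1 / (3 + 2 * sqrt 3) + \<epsilon>"
  have sq3: "sqrt (3::real) > 1" by simp
  then have "\<Lambda> > 0" unfolding \<Lambda>_def by linarith
  \<comment> \<open>At \<open>\<Lambda>\<close> itself the first two conditions on
    \<open>\<kappa>\<close> exclude each other; slightly to its left all of them hold strictly, as
    \<open>\<epsilon>\<close> leaves room.\<close>
  have "((\<lambda>x. 2 + 1 / (1 + 2 * x)) \<longlongrightarrow> 2 + 1 / (1 + 2 * \<Lambda>)) (at_left \<Lambda>)"
    using \<open>\<Lambda> > 0\<close> by (intro tendsto_intros) linarith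
  moreover have "2 + 1 / (1 + 2 * \<Lambda>) < e" using assms by (simp add: e_def \<Lambda>_def algebra_simps)
  ultimately have "\<forall>\<^sub>F x in at_left \<Lambda>. 2 + 1 / (1 + 2 * x) < e"
    by (rule order_tendstoD(2))
  moreover have "\<forall>\<^sub>F x in at_left \<Lambda>. x \<in> {2<..<\<Lambda>}"
    by (rule eventually_at_left_real) (use sq3 in \<open>simp add: \<Lambda>_def\<close>)
  ultimately have "\<forall>\<^sub>F x in at_left \<Lambda>. 2 + 1 / (1 + 2 * x) < e \<and> 2 < x \<and> x < \<Lambda>"
    by eventually_elim auto
  then obtain \<mu> where \<mu>: "2 + 1 / (1 + 2 * \<mu>) < e" "2 < \<mu>" "\<mu> < \<Lambda>"
    by (metis (mono_tags, lifting) eventually_happens' trivial_limit_at_left_real)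
  have "(\<mu> - 1)\<^sup>2 < (sqrt 3)\<^sup>2"
    using \<mu> by (intro power_strict_mono) (auto simp: \<Lambda>_def)
  then have \<mu>2: "\<mu> * \<mu> - 1 < 1 + 2 * \<mu>" by (simp add: power2_eq_square algebra_simps)
  have "\<mu> * \<mu> > 1" using \<mu>(2) by (intro less_1_mult) auto
  have "2 / (1 + 2 * \<mu>) < min (2 / (\<mu> * \<mu> - 1)) (2 * e / (3 + 4 * \<mu>))"
    using \<mu> \<mu>2 \<open>\<mu> * \<mu> > 1\<close> by (auto simp: field_simps)
  then obtain \<kappa>2 where \<kappa>2: "2 / (1 + 2 * \<mu>) < \<kappa>2" "\<kappa>2 < 2 / (\<mu> * \<mu> - 1)" "\<kappa>2 < 2 * e / (3 + 4 * \<mu>)"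
    using dense[of "2 / (1 + 2 * \<mu>)"] by (metis min_less_iff_conj)
  define \<kappa> where "\<kappa> = sqrt \<kappa>2"
  have "\<kappa>2 > 0" using \<kappa>2(1) \<mu>(2) by (smt (verit) divide_pos_pos)
  then have \<kappa>: "\<kappa> > 0" "\<kappa> * \<kappa> = \<kappa>2" by (simp_all add: \<kappa>_def)
  define n l where "n = (\<lambda>s::nat. nat \<lceil>\<kappa> * sqrt (real s)\<rceil>)" and "l = (\<lambda>s. nat \<lfloor>\<mu> * real (n s)\<rfloor>)"
  define a b c where "a = (\<lambda>s. real (n s) / sqrt (real s))" and "b = (\<lambda>s. real (l s) / sqrt (real s))"
    and "c = (\<lambda>s. 1 / sqrt (real s))"
  have lim: "a \<longlonglongrightarrow> \<kappa>" "b \<longlonglongrightarrow> \<mu> * \<kappa>" "c \<longlonglongrightarrow> 0"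
    unfolding a_def b_def c_def n_def l_def using tendsto_ceiling_mult_sqrt[OF \<kappa>(1), of \<mu>] \<mu>(2) by simp_all
  note [tendsto_intros] = lim
  \<comment> \<open>Each inequality is divided by \<open>sqrt s\<close> or \<open>s\<close> and
    becomes polynomial in \<open>a\<close>, \<open>b\<close>, \<open>c\<close> with a positive limit
    of the difference of its sides; \<open>c\<close> carries the terms of lower order.\<close>
  have "(\<lambda>s. b s - a s - c s) \<longlonglongrightarrow> \<mu> * \<kappa> - \<kappa> - 0" by (intro tendsto_intros)
  moreover have "0 < \<mu> * \<kappa> - \<kappa> - 0" using \<mu>(2) \<kappa>(1) by simp
  ultimately have ev1: "\<forall>\<^sub>F s in sequentially. 0 < b s - a s - c s" by (rule order_tendstoD(1))
  have "(\<lambda>s. b s - 10 * c s) \<longlonglongrightarrow> \<mu> * \<kappa> - 10 * 0" by (intro tendsto_intros)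
  moreover have "0 < \<mu> * \<kappa> - 10 * 0" using \<mu>(2) \<kappa>(1) by simp
  ultimately have ev2: "\<forall>\<^sub>F s in sequentially. 0 < b s - 10 * c s" by (rule order_tendstoD(1))
  have "(\<lambda>s. 1 + a s * a s + b s * a s - (a s + b s) * (a s + b s - c s) / 2) \<longlonglongrightarrow>
      1 + \<kappa> * \<kappa> + \<mu> * \<kappa> * \<kappa> - (\<kappa> + \<mu> * \<kappa>) * (\<kappa> + \<mu> * \<kappa> - 0) / 2" by (intro tendsto_intros) auto
  moreover have "0 < 1 + \<kappa> * \<kappa> + \<mu> * \<kappa> * \<kappa> - (\<kappa> + \<mu> * \<kappa>) * (\<kappa> + \<mu> * \<kappa> - 0) / 2"
  proof -
    have "1 + \<kappa> * \<kappa> + \<mu> * \<kappa> * \<kappa> - (\<kappa> + \<mu> * \<kappa>) * (\<kappa> + \<mu> * \<kappa> - 0) / 2 = 1 - (\<kappa> * \<kappa>) * (\<mu> * \<mu> - 1) / 2"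
      by (simp add: field_simps)
    then show ?thesis using \<kappa>2(2) \<open>\<mu> * \<mu> > 1\<close> unfolding \<kappa>(2) by (simp add: field_simps)
  qed
  ultimately have ev3: "\<forall>\<^sub>F s in sequentially.
      0 < 1 + a s * a s + b s * a s - (a s + b s) * (a s + b s - c s) / 2" by (rule order_tendstoD(1))
  have "(\<lambda>s. (3 * a s * a s + a s * c s) / 2 + b s * (2 * a s + c s)
        - 12 * c s * c s - 1 - w * (a s + b s) * c s - a s * a s - b s * a s) \<longlonglongrightarrow>
      (3 * \<kappa> * \<kappa> + \<kappa> * 0) / 2 + \<mu> * \<kappa> * (2 * \<kappa> + 0)
        - 12 * 0 * 0 - 1 - w * (\<kappa> + \<mu> * \<kappa>) * 0 - \<kappa> * \<kappa> - \<mu> * \<kappa> * \<kappa>" by (intro tendsto_intros) auto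
  moreover have "0 < (3 * \<kappa> * \<kappa> + \<kappa> * 0) / 2 + \<mu> * \<kappa> * (2 * \<kappa> + 0)
        - 12 * 0 * 0 - 1 - w * (\<kappa> + \<mu> * \<kappa>) * 0 - \<kappa> * \<kappa> - \<mu> * \<kappa> * \<kappa>"
  proof -
    have "(3 * \<kappa> * \<kappa> + \<kappa> * 0) / 2 + \<mu> * \<kappa> * (2 * \<kappa> + 0)
        - 12 * 0 * 0 - 1 - w * (\<kappa> + \<mu> * \<kappa>) * 0 - \<kappa> * \<kappa> - \<mu> * \<kappa> * \<kappa> = (\<kappa> * \<kappa>) * (1 + 2 * \<mu>) / 2 - 1"
      by (simp add: field_simps)
    then show ?thesis using \<kappa>2(1) \<mu>(2) unfolding \<kappa>(2) by (simp add: field_simps)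
  qed
  ultimately have ev4: "\<forall>\<^sub>F s in sequentially. 0 < (3 * a s * a s + a s * c s) / 2 + b s * (2 * a s + c s)
        - 12 * c s * c s - 1 - w * (a s + b s) * c s - a s * a s - b s * a s" by (rule order_tendstoD(1))
  have "(\<lambda>s. e * (1 - real (4 * w + 1) * c s * c s) - (3 * a s * a s + a s * c s) / 2 - b s * (2 * a s + c s)
        - w * (2 * a s + c s) * c s - 5 * c s * c s - 2 * a s * c s - b s * c s) \<longlonglongrightarrow>
      e * (1 - real (4 * w + 1) * 0 * 0) - (3 * \<kappa> * \<kappa> + \<kappa> * 0) / 2 - \<mu> * \<kappa> * (2 * \<kappa> + 0)
        - w * (2 * \<kappa> + 0) * 0 - 5 * 0 * 0 - 2 * \<kappa> * 0 - \<mu> * \<kappa> * 0" by (intro tendsto_intros) auto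
  moreover have "0 < e * (1 - real (4 * w + 1) * 0 * 0) - (3 * \<kappa> * \<kappa> + \<kappa> * 0) / 2 - \<mu> * \<kappa> * (2 * \<kappa> + 0)
        - w * (2 * \<kappa> + 0) * 0 - 5 * 0 * 0 - 2 * \<kappa> * 0 - \<mu> * \<kappa> * 0"
  proof -
    have "e * (1 - real (4 * w + 1) * 0 * 0) - (3 * \<kappa> * \<kappa> + \<kappa> * 0) / 2 - \<mu> * \<kappa> * (2 * \<kappa> + 0)
        - w * (2 * \<kappa> + 0) * 0 - 5 * 0 * 0 - 2 * \<kappa> * 0 - \<mu> * \<kappa> * 0 = e - (\<kappa> * \<kappa>) * (3 + 4 * \<mu>) / 2"
      by (simp add: field_simps)
    then show ?thesis using \<kappa>2(3) \<mu>(2) unfolding \<kappa>(2) by (simp add: field_simps)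
  qed
  ultimately have ev5: "\<forall>\<^sub>F s in sequentially.
      0 < e * (1 - real (4 * w + 1) * c s * c s) - (3 * a s * a s + a s * c s) / 2 - b s * (2 * a s + c s)
        - w * (2 * a s + c s) * c s - 5 * c s * c s - 2 * a s * c s - b s * c s" by (rule order_tendstoD(1))
  have "\<forall>\<^sub>F s::nat in sequentially. s > 0" by (rule eventually_gt_at_top)
  from this ev1 ev2 ev3 ev4 ev5 show ?thesis
  proof eventually_elim
    case (elim s)
    define r where "r = sqrt (real s)"
    have r: "r > 0" "real s = r * r" using elim(1) by (simp_all add: r_def)
    define A B C where "A = a s" and "B = b s" and "C = c s"
    \<comment> \<open>The relation \<open>C * r = 1\<close> makes every expression homogeneous in
      \<open>r\<close>, so that a power of \<open>r\<close> factors out below.\<close>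
    have eqs: "real (n s) = A * r" "real (l s) = B * r" "C * r = 1"
      using r(1) by (simp_all add: A_def B_def C_def a_def b_def c_def r_def)
    note el = elim(2-)[folded A_def B_def C_def]
    have 1: "real (n s) + 1 \<le> real (l s)"
    proof -
      have "real (l s) - real (n s) - C * r = (B - A - C) * r"
        unfolding eqs(1,2) by (simp add: algebra_simps)
      then show ?thesis using mult_pos_pos[OF el(1) r(1)] eqs(3) by linarith
    qed
    have 2: "10 \<le> real (l s)"
    proof -
      have "real (l s) - 10 * (C * r) = (B - 10 * C) * r"
        unfolding eqs(1,2) by (simp add: algebra_simps)
      then show ?thesis using mult_pos_pos[OF el(2) r(1)] eqs(3) by linarith
    qed
    have rr: "r * r > 0" using r(1) by simp
    have 3: "real (n s + l s choose 2) \<le> real (s + n s * n s + l s * n s)"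
    proof -
      have "real (s + n s * n s + l s * n s) - real (n s + l s choose 2) =
          r * r + (A * r) * (A * r) + (B * r) * (A * r) - (A * r + B * r) * (A * r + B * r - C * r) / 2"
        unfolding real_choose_two of_nat_add of_nat_mult r(2) eqs ..
      also have "\<dots> = (1 + A * A + B * A - (A + B) * (A + B - C) / 2) * (r * r)"
        by (simp add: field_simps)
      finally show ?thesis using mult_pos_pos[OF el(3) rr] by linarith
    qed
    have 4: "real (12 + s + w * (n s + l s) + (n s * n s + l s * n s)) \<le>
        real ((\<Sum>i=n s+1..n s+n s. i) + l s * (2 * n s + 1))"
    proof -
      have "real ((\<Sum>i=n s+1..n s+n s. i) + l s * (2 * n s + 1)) -
            real (12 + s + w * (n s + l s) + (n s * n s + l s * n s)) =
          (3 * (A * r) * (A * r) + (A * r) * (C * r)) / 2 + (B * r) * (2 * (A * r) + C * r)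
          - (12 * (C * r) * (C * r) + r * r + w * (A * r + B * r) * (C * r) + ((A * r) * (A * r) + (B * r) * (A * r)))"
        unfolding of_nat_add[of "sum _ _"] real_sum_consecutive
        unfolding of_nat_add of_nat_mult r(2) eqs of_nat_numeral of_nat_1 by simp
      also have "\<dots> = ((3 * A * A + A * C) / 2 + B * (2 * A + C)
          - 12 * C * C - 1 - w * (A + B) * C - A * A - B * A) * (r * r)"
        by (simp add: field_simps)
      finally show ?thesis using mult_pos_pos[OF el(4) rr] by linarith
    qed
    have 5: "real ((\<Sum>i=n s+1..n s+n s. i) + l s * (2 * n s + 1) + w * (2 * n s + 1) + 5 + 2 * n s + l s)
        \<le> e * (real s - real (4 * w + 1))"
    proof -
      have "e * (real s - real (4 * w + 1)) -
            real ((\<Sum>i=n s+1..n s+n s. i) + l s * (2 * n s + 1) + w * (2 * n s + 1) + 5 + 2 * n s + l s) =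
          e * (r * r - real (4 * w + 1) * (C * r) * (C * r)) - ((3 * (A * r) * (A * r) + (A * r) * (C * r)) / 2
          + (B * r) * (2 * (A * r) + C * r) + w * (2 * (A * r) + C * r) * (C * r)
          + 5 * (C * r) * (C * r) + 2 * (A * r) * (C * r) + (B * r) * (C * r))"
        unfolding of_nat_add[of "sum _ _ + _ + _ + _ + _"] of_nat_add[of "sum _ _ + _ + _ + _"]
          of_nat_add[of "sum _ _ + _ + _"] of_nat_add[of "sum _ _ + _"] of_nat_add[of "sum _ _"]
          real_sum_consecutive
        unfolding of_nat_add of_nat_mult r(2) eqs of_nat_numeral of_nat_1 by simp
      also have "\<dots> = (e * (1 - real (4 * w + 1) * C * C) - (3 * A * A + A * C) / 2 - B * (2 * A + C)
          - w * (2 * A + C) * C - 5 * C * C - 2 * A * C - B * C) * (r * r)"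
        by (simp add: field_simps)
      finally show ?thesis using mult_pos_pos[OF el(5) rr] by linarith
    qed
    show ?case
      by (rule exI[of _ "n s"], rule exI[of _ "l s"])
        (use 1 2 3[unfolded of_nat_le_iff] 4[unfolded of_nat_le_iff] 5[unfolded e_def] in auto)
  qed
qed

section \<open>The bound for large \<open>N\<close>\<close>

text \<open>As \<open>u\<close> and \<open>v\<close> are integers,
  \<open>\<bar>u / v\<bar> \<le> 1 - 1/v\<close>, hence the value of the series is at most
  \<open>4 * v\<close> in size, uniformly in \<open>u\<close>.\<close>

lemma one_le_abs_q_exp_diff:
  fixes d u v :: int and x :: real
  assumes "\<bar>d\<bar> \<ge> 2" "v > 0" "\<bar>u\<bar> < v" "\<bar>x\<bar> \<ge> 4 * v + 1"
  shows "1 \<le> \<bar>q_exp (1 / d) (u / v) - x\<bar>"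
proof -
  have q: "\<bar>1 / real_of_int d\<bar> \<le> 1/2" using assms(1) by (simp add: abs_divide field_simps)
  have t: "\<bar>real_of_int u / v\<bar> < 1" using assms(2,3) by (simp add: abs_divide)
  have "real_of_int \<bar>u\<bar> \<le> real_of_int (v - 1)" using assms(3) by (subst of_int_le_iff) linarith
  then have "1 / real_of_int v \<le> 1 - \<bar>real_of_int u / v\<bar>"
    using assms(2) by (simp add: abs_divide field_simps)
  then have "4 / (1 - \<bar>real_of_int u / v\<bar>) \<le> 4 / (1 / real_of_int v)"
    using assms(2) t by (intro divide_left_mono mult_pos_pos) auto
  then have "\<bar>q_exp (1 / real_of_int d) (u / v)\<bar> \<le> 4 * v" using abs_q_exp_le[OF q t] by simp
  then show ?thesis using assms(4) by linarith
qed

text \<open>The threshold is uniform in \<open>u\<close> and \<open>s\<close>. If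
  \<open>d^s / N\<close> is far too large or too small, the difference is trivially large. Otherwise
  \<open>\<bar>d\<bar>^s\<close> and \<open>\<bar>N\<bar>\<close> agree up to constants, so a large
  \<open>N\<close> forces a large \<open>s\<close> and the parameters for \<open>s\<close>
  apply.\<close>

lemma q_exp_approx_eventually:
  fixes d v :: int
  assumes d: "\<bar>d\<bar> \<ge> 2" and v: "v > 0" and \<epsilon>: "\<epsilon> > 0"
  shows "\<exists>N0. \<forall>N u s. \<bar>N\<bar> \<ge> N0 \<and> u \<noteq> 0 \<and> \<bar>u\<bar> < v \<longrightarrow>
    (2 * real_of_int \<bar>N\<bar>) powr (- (2 + 1 / (3 + 2 * sqrt 3) + \<epsilon>)) \<le> \<bar>q_exp (1 / d) (u / v) - real_of_int d ^ s / N\<bar>"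
proof -
  define w where "w = nat v"
  define p where "p = real_of_int \<bar>d\<bar>"
  define e where "e = 2 + 1 / (3 + 2 * sqrt 3) + \<epsilon>"
  have p: "p \<ge> 2" using d by (simp add: p_def)
  have e: "e \<ge> 1" using \<epsilon> by (simp add: e_def)
  have w: "real_of_int v = real w" using v by (simp add: w_def)
  have pow2: "2 ^ k \<le> p ^ k" for k using p by (intro power_mono) auto
  have "real w \<le> 2 ^ w" using of_nat_less_two_power[of w, where 'a = real] by linarith
  then have vp: "real_of_int v \<le> p ^ w" using pow2[of w] w by linarith
  have "real (4 * w + 1) \<le> 2 ^ (4 * w + 1)"
    using of_nat_less_two_power[of "4 * w + 1", where 'a = real] by linarith
  then have vp4: "4 * real_of_int v + 1 \<le> p ^ (4 * w + 1)" using pow2[of "4 * w + 1"] w by simp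
  obtain S where S: "\<And>s. s \<ge> S \<Longrightarrow> \<exists>n l. n + 1 \<le> l \<and> 10 \<le> l \<and> (n + l choose 2) \<le> s + n * n + l * n \<and>
      12 + s + w * (n + l) + (n * n + l * n) \<le> (\<Sum>i=n+1..n+n. i) + l * (2 * n + 1) \<and>
      real ((\<Sum>i=n+1..n+n. i) + l * (2 * n + 1) + w * (2 * n + 1) + 5 + 2 * n + l)
        \<le> e * (real s - real (4 * w + 1))"
    using eventually_pade_parameters[OF \<epsilon>, of w] unfolding eventually_sequentially e_def by blast
  show ?thesis
  \<comment> \<open>In the main case \<open>\<bar>N\<bar> \<le> 64 * \<bar>d\<bar>^s\<close>, so
    this threshold gives \<open>S \<le> s\<close>.\<close>
  proof (intro exI[of _ "64 * \<bar>d\<bar> ^ S"] allI impI; elim conjE)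
    fix N u :: int and s :: nat
    assume N0: "64 * \<bar>d\<bar> ^ S \<le> \<bar>N\<bar>" and u: "u \<noteq> 0" "\<bar>u\<bar> < v"
    define M where "M = real_of_int \<bar>N\<bar>"
    define x where "x = real_of_int d ^ s / N"
    define E where "E = q_exp (1 / real_of_int d) (u / v)"
    have "real_of_int (64 * \<bar>d\<bar> ^ S) \<le> real_of_int \<bar>N\<bar>" using N0 by (simp only: of_int_le_iff)
    then have MS: "64 * p ^ S \<le> M" by (simp add: M_def p_def)
    moreover have "1 \<le> p ^ S" using p by (intro one_le_power) auto
    ultimately have M: "M \<ge> 64" by linarith
    then have N: "N \<noteq> 0" by (auto simp: M_def)
    have x: "\<bar>x\<bar> = p ^ s / M" by (simp add: x_def p_def M_def abs_divide power_abs)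
    have "(2 * M) powr (- e) \<le> \<bar>E - x\<bar>"
    proof (cases "\<bar>x\<bar> \<ge> 4 * v + 1 \<or> \<bar>x\<bar> \<le> 1/64")
      case True
      have "(2 * M) powr (- e) \<le> (2 * M) powr (- 1)" using M e by (intro powr_mono) auto
      also have "\<dots> = 1 / (2 * M)" using M by (simp add: powr_minus_divide)
      also have "\<dots> \<le> 1 / 64" using M by (intro divide_left_mono) auto
      finally have small: "(2 * M) powr (- e) \<le> 1 / 64" .
      from True show ?thesis
      proof
        assume "\<bar>x\<bar> \<ge> 4 * v + 1"
        from one_le_abs_q_exp_diff[OF d v u(2) this] small show ?thesis unfolding E_def by linarith
      next
        assume "\<bar>x\<bar> \<le> 1/64"
        moreover have "\<bar>E\<bar> \<ge> 1/32" unfolding E_def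
          using d v u(2) by (intro abs_q_exp_ge) (auto simp: abs_divide field_simps)
        ultimately show ?thesis using small by linarith
      qed
    next
      case False
      then have ps: "p ^ s \<le> (4 * real_of_int v + 1) * M" and Ms: "M \<le> 64 * p ^ s"
        using M unfolding x by (auto simp: field_simps)
      have "p ^ S \<le> p ^ s" using MS Ms by linarith
      then have "S \<le> s" using p by (subst (asm) power_increasing_iff) auto
      from S[OF this] obtain n l where nl: "n + 1 \<le> l" "10 \<le> l" "(n + l choose 2) \<le> s + n * n + l * n"
        "12 + s + w * (n + l) + (n * n + l * n) \<le> (\<Sum>i=n+1..n+n. i) + l * (2 * n + 1)"
        "real ((\<Sum>i=n+1..n+n. i) + l * (2 * n + 1) + w * (2 * n + 1) + 5 + 2 * n + l)
          \<le> e * (real s - real (4 * w + 1))" by blast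
      define X where "X = (\<Sum>i=n+1..n+n. i) + l * (2 * n + 1)"
      define Y where "Y = X + w * (2 * n + 1) + 5 + 2 * n + l"
      have vpow: "real_of_int v ^ k \<le> p ^ (w * k)" for k
        using power_mono[OF vp, of k] v by (simp add: power_mult)
      have "64 * M * real_of_int v ^ (n + l) * p ^ (n * n + l * n) \<le>
          64 * (64 * p ^ s) * p ^ (w * (n + l)) * p ^ (n * n + l * n)"
        using p M v by (intro mult_mono Ms vpow) auto
      also have "\<dots> = 2 ^ 12 * p ^ (s + w * (n + l) + (n * n + l * n))"
        by (simp add: power_add)
      also have "\<dots> \<le> p ^ 12 * p ^ (s + w * (n + l) + (n * n + l * n))"
        using p by (intro mult_right_mono pow2) auto
      also have "\<dots> = p ^ (12 + s + w * (n + l) + (n * n + l * n))"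
        by (simp add: power_add)
      also have "\<dots> \<le> p ^ X"
        using p nl(4) unfolding X_def by (intro power_increasing) auto
      finally have big: "64 * M * real_of_int v ^ (n + l) * p ^ (n * n + l * n) \<le> p ^ X" .
      have core: "1 / (32 * 3 ^ n * 2 ^ l * real_of_int v ^ (2 * n + 1) * p ^ X) \<le> \<bar>E - x\<bar>"
        unfolding E_def x_def p_def X_def
        by (rule q_exp_approx_core[OF d v u N nl(1-3) big[unfolded M_def p_def X_def]])
      have "(32::real) \<le> p ^ 5" using pow2[of 5] by simp
      moreover have "3 ^ n \<le> p ^ (2 * n)"
      proof -
        have "(3::real) ^ n \<le> (2 ^ 2) ^ n" by (intro power_mono) auto
        also have "\<dots> \<le> p ^ (2 * n)" using pow2[of "2 * n"] by (simp only: power_mult)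
        finally show ?thesis .
      qed
      ultimately have "32 * 3 ^ n * 2 ^ l * real_of_int v ^ (2 * n + 1) * p ^ X \<le>
          p ^ 5 * p ^ (2 * n) * p ^ l * p ^ (w * (2 * n + 1)) * p ^ X"
        using p v by (intro mult_mono pow2 vpow) auto
      also have "\<dots> = p ^ Y" by (simp add: Y_def power_add)
      finally have "1 / p ^ Y \<le> 1 / (32 * 3 ^ n * 2 ^ l * real_of_int v ^ (2 * n + 1) * p ^ X)"
        using p v by (intro divide_left_mono mult_pos_pos) auto
      with core have EY: "1 / p ^ Y \<le> \<bar>E - x\<bar>" by (rule order_trans[rotated])
      \<comment> \<open>This comparison turns the exponent of \<open>p\<close> into an exponent of
        \<open>2 * M\<close>; the loss \<open>4 * w + 1\<close> was allowed for in the choice of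
        \<open>n\<close> and \<open>l\<close>.\<close>
      have "p ^ s \<le> p ^ (4 * w + 1) * M"
        by (rule order_trans[OF ps]) (use M in \<open>intro mult_right_mono vp4, simp\<close>)
      then have "p ^ s / p ^ (4 * w + 1) \<le> M"
        using p by (simp add: divide_le_eq mult.commute)
      then have "p ^ s / p ^ (4 * w + 1) \<le> 2 * M" using M by linarith
      moreover have "p ^ s / p ^ (4 * w + 1) = p powr (real s - real (4 * w + 1))"
        using p by (simp only: powr_diff powr_realpow)
      ultimately have "p powr (real s - real (4 * w + 1)) \<le> 2 * M" by simp
      then have "(2 * M) powr (- e) \<le> (p powr (real s - real (4 * w + 1))) powr (- e)"
        using e p by (intro powr_mono2') auto
      also have "\<dots> = p powr (- (e * (real s - real (4 * w + 1))))"
        by (simp add: powr_powr mult.commute)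
      also have "\<dots> \<le> p powr (- real Y)"
        using nl(5) p unfolding Y_def X_def by (intro powr_mono) auto
      also have "\<dots> = 1 / p ^ Y" using p by (simp add: powr_minus_divide powr_realpow)
      finally show ?thesis using EY by linarith
    qed
    then show "(2 * real_of_int \<bar>N\<bar>) powr (- (2 + 1 / (3 + 2 * sqrt 3) + \<epsilon>)) \<le>
        \<bar>q_exp (1 / d) (u / v) - real_of_int d ^ s / N\<bar>"
      by (simp only: M_def e_def E_def x_def)
  qed
qed

text \<open>If equality held, then also with \<open>(s + k, N d\<^sup>k)\<close> in place of \<open>(s, N)\<close>, for all \<open>k\<close>.\<close>

lemma q_exp_neq:
  fixes d u v N :: int
  assumes d: "\<bar>d\<bar> \<ge> 2" and v: "v > 0" and u: "u \<noteq> 0" "\<bar>u\<bar> < v" and N: "N \<noteq> 0"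
  shows "q_exp (1 / d) (u / v) \<noteq> real_of_int d ^ s / N"
proof -
  obtain N0 where N0: "\<And>N u s. \<bar>N\<bar> \<ge> N0 \<Longrightarrow> u \<noteq> 0 \<Longrightarrow> \<bar>u\<bar> < v \<Longrightarrow>
    (2 * real_of_int \<bar>N\<bar>) powr (- (2 + 1 / (3 + 2 * sqrt 3) + 1)) \<le> \<bar>q_exp (1 / d) (u / v) - real_of_int d ^ s / N\<bar>"
    using q_exp_approx_eventually[OF d v, of 1] by auto
  define k where "k = nat N0"
  have "N0 \<le> int k" by (simp add: k_def)
  also have "int k < 2 ^ k" by (rule of_nat_less_two_power)
  also have "(2::int) ^ k \<le> \<bar>d\<bar> ^ k" using d by (intro power_mono) auto
  also have "\<dots> \<le> \<bar>N\<bar> * \<bar>d\<bar> ^ k"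
    using mult_right_mono[of 1 "\<bar>N\<bar>" "\<bar>d\<bar> ^ k"] N by simp
  finally have "\<bar>N * d ^ k\<bar> \<ge> N0" by (simp add: abs_mult power_abs)
  note N0[OF this u, of "s + k"]
  moreover have "N * d ^ k \<noteq> 0" using N d by auto
  then have "0 < (2 * real_of_int \<bar>N * d ^ k\<bar>) powr (- (2 + 1 / (3 + 2 * sqrt 3) + 1))"
    by (subst powr_gt_zero) linarith
  moreover have "real_of_int d ^ (s + k) / real_of_int (N * d ^ k) = real_of_int d ^ s / N"
    using d by (auto simp: power_add)
  ultimately show ?thesis by auto
qed

section \<open>From large \<open>N\<close> to all \<open>N\<close>\<close>

text \<open>For fixed \<open>N\<close> only finitely many pairs \<open>(u, s)\<close> give a
  difference below 1. None of these differences is zero, so a large enough \<open>e\<close> pushes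
  the left side below their minimum.\<close>

lemma q_exp_approx_each:
  fixes d v N :: int
  assumes d: "\<bar>d\<bar> \<ge> 2" and v: "v > 0" and N: "N \<noteq> 0" and K: "K \<ge> 0"
  shows "\<exists>e>0. \<forall>u s. u \<noteq> 0 \<and> \<bar>u\<bar> < v \<longrightarrow>
    (2 * real_of_int \<bar>N\<bar>) powr (- (K + e)) \<le> \<bar>q_exp (1 / d) (u / v) - real_of_int d ^ s / N\<bar>"
proof -
  define f where "f = (\<lambda>(u, s). \<bar>q_exp (1 / real_of_int d) (real_of_int u / v) - real_of_int d ^ s / N\<bar>)"
  define U where "U = {(u, s). u \<noteq> 0 \<and> \<bar>u\<bar> < v \<and> \<bar>d\<bar> ^ s < (4 * v + 1) * \<bar>N\<bar>}"
  \<comment> \<open>Inserting 1 covers an empty \<open>U\<close> and ensures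
    \<open>\<mu> \<le> 1\<close>, the bound used for pairs outside \<open>U\<close>.\<close>
  define \<mu> where "\<mu> = Min (insert 1 (f ` U))"
  have "U \<subseteq> {-v..v} \<times> {..nat ((4 * v + 1) * \<bar>N\<bar>)}"
  proof (clarsimp simp: U_def)
    fix u s assume s: "\<bar>d\<bar> ^ s < (4 * v + 1) * \<bar>N\<bar>" and u: "\<bar>u\<bar> < v"
    have "int s < 2 ^ s" by (rule of_nat_less_two_power)
    also have "(2::int) ^ s \<le> \<bar>d\<bar> ^ s" using d by (intro power_mono) auto
    finally show "- v \<le> u \<and> u \<le> v \<and> s \<le> nat ((4 * v + 1) * \<bar>N\<bar>)" using s u by linarith
  qed
  then have fin: "finite U" by (rule finite_subset) auto
  have "0 < f y" if "y \<in> U" for y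
    using that q_exp_neq[OF d v _ _ N] by (auto simp: U_def f_def)
  then have \<mu>: "0 < \<mu>" "\<mu> \<le> 1" using fin by (auto simp: \<mu>_def)
  define M where "M = 2 * real_of_int \<bar>N\<bar>"
  have M: "M > 1" using N by (simp add: M_def)
  \<comment> \<open>\<open>M powr (ln \<mu> / ln M)\<close> equals \<open>\<mu>\<close>; the summand
    1 makes \<open>e\<close> positive.\<close>
  define e where "e = 1 - ln \<mu> / ln M"
  have "ln \<mu> / ln M \<le> 0" using \<mu> M by (simp add: divide_nonpos_pos)
  then have e: "e > 0" by (simp add: e_def)
  have "M powr (- (K + e)) \<le> M powr (ln \<mu> / ln M)" using M K by (intro powr_mono) (auto simp: e_def)
  also have "\<dots> = \<mu>" using M \<mu> by (simp add: powr_def)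
  finally have le: "M powr (- (K + e)) \<le> \<mu>" .
  have "\<mu> \<le> f (u, s)" if u: "u \<noteq> 0" "\<bar>u\<bar> < v" for u s
  proof (cases "(u, s) \<in> U")
    case True
    then show ?thesis unfolding \<mu>_def using fin by (intro Min_le) auto
  next
    case False
    then have "(4 * v + 1) * \<bar>N\<bar> \<le> \<bar>d\<bar> ^ s" using u by (auto simp: U_def)
    then have "real_of_int ((4 * v + 1) * \<bar>N\<bar>) \<le> real_of_int (\<bar>d\<bar> ^ s)" by (simp only: of_int_le_iff)
    then have "4 * v + 1 \<le> \<bar>real_of_int d ^ s / N\<bar>"
      using N by (simp add: abs_divide power_abs field_simps)
    then show ?thesis using one_le_abs_q_exp_diff[OF d v u(2), of "real_of_int d ^ s / N"] \<mu>(2)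
      by (simp add: f_def)
  qed
  then have "M powr (- (K + e)) \<le> f (u, s)" if "u \<noteq> 0" "\<bar>u\<bar> < v" for u s
    using le order_trans that by blast
  then show ?thesis using e unfolding M_def f_def by (intro exI[of _ e]) simp
qed

text \<open>The infimum of the admissible positive \<open>e\<close> tends to 0, but it may be 0 or
  fail to be admissible. Adding the positive null function \<open>h\<close> cures both, since
  admissibility is upward closed.\<close>

lemma exists_vanishing_majorant:
  fixes P :: "'a \<Rightarrow> real \<Rightarrow> bool" and h :: "'a \<Rightarrow> real"
  assumes mono: "\<And>x e e'. P x e \<Longrightarrow> e \<le> e' \<Longrightarrow> P x e'"
    and ex: "\<And>x. \<exists>e>0. P x e"
    and ev: "\<And>e. e > 0 \<Longrightarrow> \<forall>\<^sub>F x in F. P x e"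
    and h: "\<And>x. h x > 0" "(h \<longlongrightarrow> 0) F"
  shows "\<exists>f. (\<forall>x. f x > 0) \<and> (f \<longlongrightarrow> 0) F \<and> (\<forall>x. P x (f x))"
proof -
  define g where "g = (\<lambda>x. Inf {e. 0 < e \<and> P x e})"
  have bdd: "bdd_below {e. 0 < e \<and> P x e}" for x by (rule bdd_belowI[of _ 0]) auto
  have ne: "{e. 0 < e \<and> P x e} \<noteq> {}" for x using ex[of x] by auto
  have g0: "g x \<ge> 0" for x unfolding g_def using ne by (intro cInf_greatest) auto
  have "(g \<longlongrightarrow> 0) F"
  proof (rule order_tendstoI)
    fix a :: real assume "a < 0"
    then show "\<forall>\<^sub>F x in F. a < g x" using g0 by (intro always_eventually) (meson less_le_trans)
  next
    fix a :: real assume a: "0 < a"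
    then have "\<forall>\<^sub>F x in F. P x (a / 2)" by (intro ev) simp
    then show "\<forall>\<^sub>F x in F. g x < a"
    proof eventually_elim
      case (elim x)
      then have "g x \<le> a / 2" unfolding g_def using a by (intro cInf_lower bdd) auto
      then show ?case using a by simp
    qed
  qed
  then have "((\<lambda>x. g x + h x) \<longlongrightarrow> 0) F" using tendsto_add[OF _ h(2)] by fastforce
  moreover have "g x + h x > 0" for x using g0[of x] h(1)[of x] by simp
  moreover have "P x (g x + h x)" for x
  proof -
    have "g x < g x + h x" using h(1) by simp
    then obtain e where "P x e" "e < g x + h x"
      using cInf_lessD[OF ne] unfolding g_def by blast
    then show ?thesis using mono by (meson less_imp_le)
  qed
  ultimately show ?thesis by (intro exI[of _ "\<lambda>x. g x + h x"]) blast
qed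

lemma q_exp_approx_exponent:
  fixes d v :: int
  assumes d: "\<bar>d\<bar> \<ge> 2" and v: "v > 0"
  shows "\<exists>f. (\<forall>N. f N > 0) \<and> (f \<longlongrightarrow> 0) (filtercomap (\<lambda>N :: int. \<bar>N\<bar>) at_top) \<and>
    (\<forall>N u s. N \<noteq> 0 \<and> u \<noteq> 0 \<and> \<bar>u\<bar> < v \<longrightarrow>
       (2 * real_of_int \<bar>N\<bar>) powr (- (2 + 1 / (3 + 2 * sqrt 3) + f N))
         \<le> \<bar>q_exp (1 / d) (u / v) - real_of_int d ^ s / N\<bar>)"
proof -
  define K :: real where "K = 2 + 1 / (3 + 2 * sqrt 3)"
  have K: "K \<ge> 0" by (simp add: K_def)
  define P where "P = (\<lambda>N e. \<forall>u s. N \<noteq> 0 \<and> u \<noteq> 0 \<and> \<bar>u\<bar> < v \<longrightarrow>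
      (2 * real_of_int \<bar>N\<bar>) powr (- (K + e)) \<le> \<bar>q_exp (1 / d) (u / v) - real_of_int d ^ s / N\<bar>)"
  have "\<exists>f. (\<forall>N. f N > 0) \<and> (f \<longlongrightarrow> 0) (filtercomap (\<lambda>N :: int. \<bar>N\<bar>) at_top) \<and> (\<forall>N. P N (f N))"
  proof (rule exists_vanishing_majorant[where h = "\<lambda>N. inverse (1 + real_of_int \<bar>N\<bar>)"])
    fix N e e' assume P: "P N e" and "e \<le> e'"
    have "(2 * real_of_int \<bar>N\<bar>) powr (- (K + e')) \<le> (2 * real_of_int \<bar>N\<bar>) powr (- (K + e))" if "N \<noteq> 0"
      using that \<open>e \<le> e'\<close> by (intro powr_mono) auto
    then show "P N e'" using P unfolding P_def by (meson order_trans)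
  next
    fix N
    show "\<exists>e>0. P N e"
    proof (cases "N = 0")
      case True
      then show ?thesis by (auto simp: P_def intro!: exI[of _ 1])
    next
      case False
      then show ?thesis using q_exp_approx_each[OF d v False K] by (auto simp: P_def)
    qed
  next
    fix e :: real assume "e > 0"
    then show "\<forall>\<^sub>F N in filtercomap abs at_top. P N e"
      using q_exp_approx_eventually[OF d v, of e]
      unfolding P_def K_def eventually_filtercomap_at_top_linorder by blast
  next
    fix N :: int
    show "0 < inverse (1 + real_of_int \<bar>N\<bar>)" by (simp add: add_pos_nonneg)
  next
    have "filterlim (\<lambda>N::int. \<bar>N\<bar>) at_top (filtercomap (\<lambda>N :: int. \<bar>N\<bar>) at_top)"
      by (rule filterlim_filtercomap)
    then have "filterlim (\<lambda>N::int. real_of_int \<bar>N\<bar>) at_top (filtercomap (\<lambda>N :: int. \<bar>N\<bar>) at_top)"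
      by (rule filterlim_compose[OF filterlim_real_of_int_at_top])
    then show "((\<lambda>N. inverse (1 + real_of_int \<bar>N\<bar>)) \<longlongrightarrow> 0) (filtercomap abs at_top)"
      by (intro tendsto_inverse_0_at_top filterlim_tendsto_add_at_top[OF tendsto_const])
  qed
  then show ?thesis unfolding P_def K_def by blast
qed

section \<open>Effectiveness of the constant 1\<close>

text \<open>Primitive recursion adding 2 at each step; \<open>xs ! 1\<close> is the previous value
  in the argument list of the step function.\<close>

lemma recursive_fun_double: "recursive_fun 1 (\<lambda>xs. 2 * hd xs)"
proof -
  have "recursive_fun 2 (\<lambda>xs. Suc (xs ! 1))"
    using comp[of "[\<lambda>xs. xs ! 1]" "\<lambda>xs. Suc (hd xs)" 2] succ proj[of 1 2] by simp
  then have "recursive_fun 2 (\<lambda>xs. Suc (Suc (xs ! 1)))"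
    using comp[of "[\<lambda>xs. Suc (xs ! 1)]" "\<lambda>xs. Suc (hd xs)" 2] succ by simp
  then have "recursive_fun (Suc 0) (\<lambda>xs. rec_nat 0 (\<lambda>i r. Suc (Suc ((i # r # tl xs) ! 1))) (hd xs))"
    using prim_rec[OF zero[of 0], of "\<lambda>xs. Suc (Suc (xs ! 1))"] by (simp add: numeral_2_eq_2)
  moreover have "rec_nat 0 (\<lambda>i r. Suc (Suc ((i # r # tl xs) ! 1))) k = 2 * k" for k and xs :: "nat list"
    by (induction k) auto
  ultimately show ?thesis by simp
qed

text \<open>Computes the code of \<open>2^n\<close>, the numerator of 1 at precision
  \<open>n\<close>: \<open>int_encode\<close> doubles nonnegative integers, whence the exponent
  \<open>Suc\<close>.\<close>

lemma recursive_fun_power_two: "recursive_fun 1 (\<lambda>xs. 2 ^ Suc (hd xs))"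
proof -
  have "recursive_fun 0 (\<lambda>xs. Suc 0)"
    using comp[of "[\<lambda>xs. 0]" "\<lambda>xs. Suc (hd xs)" 0] succ zero[of 0] by simp
  then have two: "recursive_fun 0 (\<lambda>xs. 2)"
    using comp[of "[\<lambda>xs. Suc 0]" "\<lambda>xs. Suc (hd xs)" 0] succ by (simp add: numeral_2_eq_2)
  have "recursive_fun 2 (\<lambda>xs. 2 * (xs ! 1))"
    using comp[of "[\<lambda>xs. xs ! 1]" "\<lambda>xs. 2 * hd xs" 2] recursive_fun_double proj[of 1 2] by simp
  then have "recursive_fun (Suc 0) (\<lambda>xs. rec_nat 2 (\<lambda>i r. 2 * ((i # r # tl xs) ! 1)) (hd xs))"
    using prim_rec[OF two, of "\<lambda>xs. 2 * (xs ! 1)"] by (simp add: numeral_2_eq_2)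
  moreover have "rec_nat 2 (\<lambda>i r. 2 * ((i # r # tl xs) ! 1)) k = 2 ^ Suc k" for k and xs :: "nat list"
    by (induction k) auto
  ultimately show ?thesis by simp
qed

lemma effective_const_1: "effective_const (\<lambda>_ _. 1)"
proof -
  have "recursive_fun 3 (\<lambda>xs. 2 ^ Suc (xs ! 2))"
    using comp[of "[\<lambda>xs. xs ! 2]" "\<lambda>xs. 2 ^ Suc (hd xs)" 3] recursive_fun_power_two proj[of 2 3] by simp
  moreover have "int_decode (2 ^ Suc n) = 2 ^ n" for n
    by (simp add: int_decode_def sum_decode_def)
  ultimately show ?thesis
    unfolding effective_const_def by (intro exI[of _ "\<lambda>xs. 2 ^ Suc (xs ! 2)"]) simp
qed

theorem theorem2:
  shows "\<exists>(C\<^sub>2 :: int \<Rightarrow> int \<Rightarrow> real) (\<epsilon>\<^sub>2 :: int \<Rightarrow> int \<Rightarrow> int \<Rightarrow> real).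
    effective_const C\<^sub>2 \<and>
    (\<forall>d v :: int. \<bar>d\<bar> \<ge> 2 \<and> v > 0 \<longrightarrow>
       C\<^sub>2 d v > 0 \<and>
       (\<forall>N. \<epsilon>\<^sub>2 d v N > 0) \<and>
       (\<epsilon>\<^sub>2 d v \<longlongrightarrow> 0) (filtercomap (\<lambda>N :: int. \<bar>N\<bar>) at_top) \<and>
       (\<forall>(u :: int) (t :: real) (q :: real).
          coprime u v \<and> t = real_of_int u / real_of_int v \<and> 0 < \<bar>t\<bar> \<and> \<bar>t\<bar> < 1 \<and>
          q = 1 / real_of_int d \<longrightarrow>
          (\<forall>(s :: nat) (N :: int). s > 0 \<and> \<bar>N\<bar> \<ge> 82836 \<longrightarrow>
             \<bar>q_exp q t - real_of_int d ^ s / real_of_int N\<bar>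
               \<ge> C\<^sub>2 d v * (2 * real_of_int \<bar>N\<bar>) powr (- (2 + 1 / (3 + 2 * sqrt 3) + \<epsilon>\<^sub>2 d v N)))))"
proof -
  define G where "G = (\<lambda>(d::int) (v::int) (f :: int \<Rightarrow> real).
    (\<forall>N. f N > 0) \<and> (f \<longlongrightarrow> 0) (filtercomap (\<lambda>N :: int. \<bar>N\<bar>) at_top) \<and>
    (\<forall>(N::int) (u::int) (s::nat). N \<noteq> 0 \<and> u \<noteq> 0 \<and> \<bar>u\<bar> < v \<longrightarrow>
       (2 * real_of_int \<bar>N\<bar>) powr (- (2 + 1 / (3 + 2 * sqrt 3) + f N))
         \<le> \<bar>q_exp (1 / d) (u / v) - real_of_int d ^ s / N\<bar>))"
  \<comment> \<open>The exponents found for each pair \<open>(d, v)\<close> are gathered into one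
    function by choice.\<close>
  have "\<exists>\<epsilon>. \<forall>d v. \<bar>d\<bar> \<ge> 2 \<and> v > 0 \<longrightarrow> G d v (\<epsilon> d v)"
    using q_exp_approx_exponent unfolding G_def by (intro choice allI) simp
  then obtain \<epsilon> where \<epsilon>: "\<And>d v. \<bar>d\<bar> \<ge> 2 \<Longrightarrow> v > 0 \<Longrightarrow> G d v (\<epsilon> d v)" by blast
  show ?thesis
  proof (intro exI[of _ "\<lambda>_ _. 1"] exI[of _ \<epsilon>] conjI allI impI effective_const_1; (elim conjE)?)
    fix d v :: int assume "\<bar>d\<bar> \<ge> 2" "v > 0"
    note G = \<epsilon>[OF this, unfolded G_def]
    show "\<epsilon> d v N > 0" for N using G by blast
    show "(\<epsilon> d v \<longlongrightarrow> 0) (filtercomap (\<lambda>N :: int. \<bar>N\<bar>) at_top)" using G by blast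
    fix u :: int and t q :: real and s :: nat and N :: int
    assume *: "t = real_of_int u / real_of_int v" "0 < \<bar>t\<bar>" "\<bar>t\<bar> < 1" "q = 1 / real_of_int d" "82836 \<le> \<bar>N\<bar>"
    then have "u \<noteq> 0" "\<bar>u\<bar> < v" "N \<noteq> 0" using \<open>v > 0\<close> by (auto simp: abs_divide)
    then show "1 * (2 * real_of_int \<bar>N\<bar>) powr (- (2 + 1 / (3 + 2 * sqrt 3) + \<epsilon> d v N))
        \<le> \<bar>q_exp q t - real_of_int d ^ s / real_of_int N\<bar>"
      using G *(1,4) by simp
  qed simp
qed

end
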